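(* There is a function $C(\Delta,q)$ such that the following holds. For any tree $T$ with maximum degree $\Delta$ and $n$ vertices, and any integer $q \geq \Delta + 2$, the relaxation time of the Glauber dynamics for $q$-edge-colorings of $T$ satisfies $T_{\mathrm{rel}} \leq C(\Delta,q)\, n$, i.e. $T_{\mathrm{rel}} = O_{\Delta,q}(n)$, where the big-$O$ hides a factor depending only on $\Delta$ and $q$.
   Context: For a graph $G=(V,E)$ and integer $q\ge 2$, a proper $q$-edge-coloring is $\sigma\in[q]^E$ with $\sigma(e)\neq\sigma(f)$ whenever $e,f$ are distinct edges sharing an endpoint; $\Omega$ is the set of these and $\mu$ the uniform distribution on $\Omega$. The Glauber dynamics: from $X_t\in\Omega$, choose an edge $e\in E$ and a color $c\in[q]$ uniformly at random; if no edge adjacent to $e$ has color $c$ in $X_t$, set $X_{t+1}(e)=c$, otherwise $X_{t+1}(e)=X_t(e)$; all other edges keep their colors. For trees with $q\ge\Delta+1$ this chain is ergodic with stationary distribution $\mu$. If $1=\lambda_1>\lambda_2\ge\dots\ge\lambda_{|\Omega|}>-1$ are the eigenvalues of its transition matrix and $\lambda_*=\max\{\lambda_2,|\lambda_{|\Omega|}|\}$, the relaxation time is $T_{\mathrm{rel}}=(1-\lambda_* )^{-1}$. *)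

theory Defs
  imports
    "Jordan_Normal_Form.Char_Poly"
    "HOL-Library.Countable_Set"
    "HOL-Library.Extended_Real"
begin

text \<open>A finite simple graph is a vertex set together with a set of two-element subsets of it.\<close>

definition simple_graph :: "'v set \<Rightarrow> 'v set set \<Rightarrow> bool" where
  "simple_graph V E \<longleftrightarrow> finite V \<and> (\<forall>e\<in>E. e \<subseteq> V \<and> card e = 2)"

definition graph_connected :: "'v set \<Rightarrow> 'v set set \<Rightarrow> bool" where
  "graph_connected V E \<longleftrightarrow> V \<noteq> {} \<and> (\<forall>u\<in>V. \<forall>v\<in>V. (u, v) \<in> {(x, y). {x, y} \<in> E}\<^sup>*)"

text \<open>A cycle is given by the list of its vertices, each listed once.\<close>

definition graph_cycle :: "'v set set \<Rightarrow> 'v list \<Rightarrow> bool" where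
  "graph_cycle E xs \<longleftrightarrow> 3 \<le> length xs \<and> distinct xs \<and>
     (\<forall>i. Suc i < length xs \<longrightarrow> {xs ! i, xs ! Suc i} \<in> E) \<and> {last xs, hd xs} \<in> E"

definition is_tree :: "'v set \<Rightarrow> 'v set set \<Rightarrow> bool" where
  "is_tree V E \<longleftrightarrow> simple_graph V E \<and> graph_connected V E \<and> (\<nexists>xs. graph_cycle E xs)"

definition graph_degree :: "'v set set \<Rightarrow> 'v \<Rightarrow> nat" where
  "graph_degree E v = card {e \<in> E. v \<in> e}"

definition max_degree :: "'v set \<Rightarrow> 'v set set \<Rightarrow> nat" where
  "max_degree V E = Max (graph_degree E ` V)"

definition adjacent_edges :: "'v set \<Rightarrow> 'v set \<Rightarrow> bool" where
  "adjacent_edges e f \<longleftrightarrow> e \<noteq> f \<and> e \<inter> f \<noteq> {}"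

text \<open>Colorings are extensional functions (undefined outside the edge set), so that two
  colorings are equal exactly if they agree on all edges.\<close>

definition edge_colorings :: "'v set set \<Rightarrow> nat \<Rightarrow> ('v set \<Rightarrow> nat) set" where
  "edge_colorings E q =
     {\<sigma> \<in> E \<rightarrow>\<^sub>E {1..q}. \<forall>e\<in>E. \<forall>f\<in>E. adjacent_edges e f \<longrightarrow> \<sigma> e \<noteq> \<sigma> f}"

definition glauber_update ::
  "'v set set \<Rightarrow> ('v set \<Rightarrow> nat) \<Rightarrow> 'v set \<Rightarrow> nat \<Rightarrow> ('v set \<Rightarrow> nat)" where
  "glauber_update E \<sigma> e c =
     (if \<exists>f\<in>E. adjacent_edges e f \<and> \<sigma> f = c then \<sigma> else \<sigma>(e := c))"

text \<open>The probability of moving from \<open>\<sigma>\<close> to \<open>\<tau>\<close> for a uniformly random pair of an edge and a color.\<close>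

definition glauber_prob ::
  "'v set set \<Rightarrow> nat \<Rightarrow> ('v set \<Rightarrow> nat) \<Rightarrow> ('v set \<Rightarrow> nat) \<Rightarrow> real" where
  "glauber_prob E q \<sigma> \<tau> =
     real (card {(e, c) \<in> E \<times> {1..q}. glauber_update E \<sigma> e c = \<tau>}) / real (card E * q)"

text \<open>The states of a finite state space \<open>S\<close> are numbered by \<^const>\<open>from_nat_into\<close>, which is a
  bijection from \<open>{..<card S}\<close> to \<open>S\<close>. The spectrum does not depend on the numbering.\<close>

definition transition_matrix :: "'s set \<Rightarrow> ('s \<Rightarrow> 's \<Rightarrow> real) \<Rightarrow> real mat" where
  "transition_matrix S P =
     mat (card S) (card S) (\<lambda>(i, j). P (from_nat_into S i) (from_nat_into S j))"

text \<open>Real eigenvalues with algebraic multiplicity, in descending order. For a symmetric (or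
  reversible) chain these are all \<open>card S\<close> eigenvalues.\<close>

definition chain_eigenvalues :: "'s set \<Rightarrow> ('s \<Rightarrow> 's \<Rightarrow> real) \<Rightarrow> real list" where
  "chain_eigenvalues S P =
     rev (sorted_list_of_multiset (proots (char_poly (transition_matrix S P))))"

text \<open>With zero-based indexing, \<open>chain_eigenvalues S P ! 1\<close> is \<open>\<lambda>\<^sub>2\<close>. A chain with a single state
  has no \<open>\<lambda>\<^sub>2\<close>; by convention \<open>\<lambda>\<^sub>*\<close> is then \<open>0\<close>. This occurs for the one-vertex tree, whose
  dynamics is degenerate because there is no edge to choose.\<close>

definition lambda_star :: "'s set \<Rightarrow> ('s \<Rightarrow> 's \<Rightarrow> real) \<Rightarrow> real" where
  "lambda_star S P =
     (if card S \<le> 1 then 0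
      else max (chain_eigenvalues S P ! 1) \<bar>last (chain_eigenvalues S P)\<bar>)"

text \<open>Extended real division gives \<open>\<infinity>\<close> if \<open>\<lambda>\<^sub>* = 1\<close>, so a finite bound on the relaxation time
  of a stochastic matrix includes \<open>\<lambda>\<^sub>* < 1\<close>.\<close>

definition relaxation_time :: "'s set \<Rightarrow> ('s \<Rightarrow> 's \<Rightarrow> real) \<Rightarrow> ereal" where
  "relaxation_time S P = 1 / ereal (1 - lambda_star S P)"

end

theory Submission
  imports Defs "Jordan_Normal_Form.Schur_Decomposition"
begin

text \<open>The heart of the proof is approximate tensorization of variance: the variance of \<open>f\<close> under the
  uniform distribution is at most \<open>C\<close> times the sum over the edges of the expected variances under
  resampling one edge, with \<open>C\<close> depending on \<open>q\<close> only. It is proved by attaching to a forest, one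
  vertex at a time, the star of child edges of a leaf. If \<open>g\<close> is the conditional expectation
  of \<open>f\<close> given the old forest, then the variance of \<open>g\<close> under resampling the parent edge is
  bounded by \<open>K'\<close> times that of \<open>f\<close> plus \<open>\<delta>\<close> times the child terms. The contraction \<open>\<delta> < 1\<close> keeps the
  constants bounded: two injective colorings of \<open>d\<close> child edges that avoid different parent colors can
  be coupled to agree with probability \<open>1 - d / (q - 1)\<close>, and the parent edge and each child edge
  have at least three available colors because \<open>q \<ge> \<Delta> + 2\<close>.\<close>

section \<open>Means and variances over finite sets\<close>

text \<open>A plain induction would lose a constant factor with every attached star and end with a
  bound exponential in the depth. The loss is therefore recorded edge by edge: only the parent edge
  is inflated, an edge is a parent at most once at each of its two ends, and the children start with
  a weight \<open>W\<close> satisfying \<open>K + \<delta> * W \<le> W\<close>.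

  The contraction must be strict after two comparisons. First, the average over the star depends on
  the parent color through the law of the star and also through \<open>f\<close> itself; splitting
  off the second dependence puts a factor \<open>(1 + \<epsilon>)^2\<close> on the child terms and
  everything large on the parent term. Second, swapping two colors available to the parent must be
  compared with resampling a child whose palette lacks the parent color; three colors on either side
  make this comparison free. What remains is the coupling rate \<open>d / (q - 1)\<close>. The
  parent edge takes one of the \<open>\<Delta>\<close> places at their common vertex, so
  \<open>d \<le> q - 3\<close>, and the gap between \<open>(q - 3) / (q - 1)\<close> and 1 absorbs
  \<epsilon>.\<close>

definition mean :: "'a set \<Rightarrow> ('a \<Rightarrow> real) \<Rightarrow> real" where
  "mean S f = (\<Sum>x\<in>S. f x) / real (card S)"

definition vari :: "'a set \<Rightarrow> ('a \<Rightarrow> real) \<Rightarrow> real" where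
  "vari S f = mean S (\<lambda>x. (f x - mean S f)\<^sup>2)"

lemma mean_cong: "S = T \<Longrightarrow> (\<And>x. x \<in> T \<Longrightarrow> f x = g x) \<Longrightarrow> mean S f = mean T g"
  unfolding mean_def by (auto intro: sum.cong)

lemma mean_mono: "(\<And>x. x \<in> S \<Longrightarrow> f x \<le> g x) \<Longrightarrow> mean S f \<le> mean S g"
  unfolding mean_def by (auto intro!: divide_right_mono sum_mono)

lemma mean_nonneg: "(\<And>x. x \<in> S \<Longrightarrow> 0 \<le> f x) \<Longrightarrow> 0 \<le> mean S f"
  unfolding mean_def by (auto intro!: divide_nonneg_nonneg sum_nonneg)

lemma vari_nonneg: "0 \<le> vari S f"
  unfolding vari_def by (rule mean_nonneg) simp

lemma mean_add: "mean S (\<lambda>x. f x + g x) = mean S f + mean S g"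
  unfolding mean_def by (simp add: sum.distrib add_divide_distrib)

lemma mean_diff: "mean S (\<lambda>x. f x - g x) = mean S f - mean S g"
  unfolding mean_def by (simp add: sum_subtractf diff_divide_distrib)

lemma mean_cmult: "mean S (\<lambda>x. c * f x) = c * mean S f"
  unfolding mean_def by (simp add: sum_distrib_left)

lemma mean_sum: "mean S (\<lambda>x. \<Sum>i\<in>I. f i x) = (\<Sum>i\<in>I. mean S (f i))"
  unfolding mean_def by (simp add: sum.swap[of _ I] sum_divide_distrib)

lemma mean_const: "finite S \<Longrightarrow> S \<noteq> {} \<Longrightarrow> mean S (\<lambda>x. c) = c"
  unfolding mean_def by simp

lemma mean_swap: "mean S (\<lambda>x. mean T (f x)) = mean T (\<lambda>y. mean S (\<lambda>x. f x y))"
  unfolding mean_def by (simp add: sum_divide_distrib[symmetric] sum.swap[of _ S] mult.commute)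

lemma vari_eq: "vari S f = mean S (\<lambda>x. (f x)\<^sup>2) - (mean S f)\<^sup>2"
proof (cases "finite S \<and> S \<noteq> {}")
  case True
  have "vari S f = mean S (\<lambda>x. (f x)\<^sup>2 - 2 * mean S f * f x + (mean S f)\<^sup>2)"
    unfolding vari_def by (intro mean_cong) (auto simp: power2_eq_square algebra_simps)
  also have "\<dots> = mean S (\<lambda>x. (f x)\<^sup>2) - 2 * mean S f * mean S f + (mean S f)\<^sup>2"
    using True by (simp add: mean_add mean_diff mean_cmult mean_const)
  finally show ?thesis by (simp add: power2_eq_square)
next
  \<comment> \<open>On empty or infinite sets both sum and cardinality are 0 and
    \<open>0 / 0 = 0\<close>; this convention keeps most of these laws free of finiteness
    conditions.\<close>
  case False
  then show ?thesis by (auto simp: vari_def mean_def)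
qed

lemma mean_sq_le: "(mean S f)\<^sup>2 \<le> mean S (\<lambda>x. (f x)\<^sup>2)"
  using vari_nonneg[of S f] vari_eq[of S f] by linarith

lemma vari_le_mean_sq: "vari S f \<le> mean S (\<lambda>x. (f x)\<^sup>2)"
  using vari_eq[of S f] by simp

text \<open>Without the mean in it, the variance can be compared across different palettes, pair of
  colors by pair of colors.\<close>

lemma vari_pairs: "vari S f = (\<Sum>x\<in>S. \<Sum>y\<in>S. (f x - f y)\<^sup>2) / (2 * (real (card S))\<^sup>2)"
proof (cases "finite S \<and> S \<noteq> {}")
  case True
  then have n: "real (card S) \<noteq> 0" by simp
  have "(\<Sum>x\<in>S. \<Sum>y\<in>S. (f x - f y)\<^sup>2)
      = (\<Sum>x\<in>S. \<Sum>y\<in>S. (f x)\<^sup>2 + (f y)\<^sup>2 - 2 * (f x * f y))"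
    by (simp add: power2_eq_square algebra_simps)
  also have "\<dots> = 2 * (real (card S) * (\<Sum>x\<in>S. (f x)\<^sup>2)) - 2 * (\<Sum>x\<in>S. f x)\<^sup>2"
    by (simp add: sum.distrib sum_subtractf sum_distrib_left[symmetric]
        sum_distrib_right[symmetric] power2_eq_square[of "sum f S"])
  finally show ?thesis
    using n unfolding vari_eq mean_def by (simp add: divide_simps power2_eq_square)
next
  case False
  then show ?thesis by (auto simp: vari_def mean_def)
qed

text \<open>Young's inequality; a small \<open>e\<close> keeps the coefficient of \<open>a\<close>
  near 1, so that a contraction of the \<open>a\<close> part survives.\<close>

lemma square_add_le:
  fixes a b e :: real
  assumes "e > 0"
  shows "(a + b)\<^sup>2 \<le> (1 + e) * a\<^sup>2 + (1 + 1 / e) * b\<^sup>2"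
proof -
  have "0 \<le> (e * a - b)\<^sup>2 / e" using assms by simp
  also have "\<dots> = e * a\<^sup>2 - 2 * a * b + b\<^sup>2 / e"
    using assms by (simp add: field_simps power2_eq_square)
  finally show ?thesis by (simp add: power2_sum algebra_simps)
qed

lemma vari_add_le:
  assumes "e > 0"
  shows "vari S (\<lambda>x. f x + g x) \<le> (1 + e) * vari S f + (1 + 1 / e) * vari S g"
proof -
  have "vari S (\<lambda>x. f x + g x)
      = mean S (\<lambda>x. ((f x - mean S f) + (g x - mean S g))\<^sup>2)"
    unfolding vari_def mean_add by (simp add: algebra_simps)
  also have "\<dots> \<le> mean S (\<lambda>x. (1 + e) * (f x - mean S f)\<^sup>2 + (1 + 1 / e) * (g x - mean S g)\<^sup>2)"
    by (intro mean_mono square_add_le assms)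
  finally show ?thesis by (simp add: mean_add mean_cmult vari_def)
qed

text \<open>Jensen's inequality: the variance is convex in the function.\<close>

lemma vari_mean_le: "vari A (\<lambda>a. mean Y (F a)) \<le> mean Y (\<lambda>y. vari A (\<lambda>a. F a y))"
proof -
  have "vari A (\<lambda>a. mean Y (F a))
      = mean A (\<lambda>a. (mean Y (\<lambda>y. F a y - mean A (\<lambda>a. F a y)))\<^sup>2)"
    unfolding vari_def mean_diff by (simp add: mean_swap[of A Y])
  also have "\<dots> \<le> mean A (\<lambda>a. mean Y (\<lambda>y. (F a y - mean A (\<lambda>a. F a y))\<^sup>2))"
    by (intro mean_mono mean_sq_le)
  finally show ?thesis by (simp add: mean_swap[of A Y] vari_def)
qed

lemma mean_bij_betw: "bij_betw h A B \<Longrightarrow> mean B f = mean A (\<lambda>x. f (h x))"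
  unfolding mean_def by (simp add: sum.reindex_bij_betw bij_betw_same_card)

lemma vari_bij_betw: "bij_betw h A B \<Longrightarrow> vari B f = vari A (\<lambda>x. f (h x))"
  unfolding vari_def by (simp add: mean_bij_betw)

text \<open>Equal fiber sizes make the first marginal of the uniform distribution on
  \<open>Sigma X Y\<close> uniform.\<close>

lemma mean_Sigma:
  assumes "finite X" "\<And>x. x \<in> X \<Longrightarrow> finite (Y x)" "\<And>x. x \<in> X \<Longrightarrow> card (Y x) = N"
  shows "mean (Sigma X Y) f = mean X (\<lambda>x. mean (Y x) (\<lambda>y. f (x, y)))"
proof -
  have "mean (Sigma X Y) f = (\<Sum>x\<in>X. \<Sum>y\<in>Y x. f (x, y)) / (real (card X) * real N)"
    using assms by (simp add: mean_def sum.Sigma)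
  also have "\<dots> = mean X (\<lambda>x. mean (Y x) (\<lambda>y. f (x, y)))"
    using assms(3) by (simp add: mean_def sum_divide_distrib mult.commute cong: sum.cong)
  finally show ?thesis .
qed

text \<open>Law of total variance.\<close>

lemma vari_Sigma:
  assumes "finite X" "\<And>x. x \<in> X \<Longrightarrow> finite (Y x)" "\<And>x. x \<in> X \<Longrightarrow> card (Y x) = N"
  shows "vari (Sigma X Y) f = mean X (\<lambda>x. vari (Y x) (\<lambda>y. f (x, y)))
           + vari X (\<lambda>x. mean (Y x) (\<lambda>y. f (x, y)))"
  by (simp add: vari_eq mean_Sigma[OF assms] mean_diff)

section \<open>Injections into a palette: the proper colorings of a star\<close>

definition injections :: "'a set \<Rightarrow> 'b set \<Rightarrow> ('a \<Rightarrow> 'b) set" where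
  "injections D S = {y \<in> D \<rightarrow>\<^sub>E S. inj_on y D}"

lemma finite_injections: "finite D \<Longrightarrow> finite S \<Longrightarrow> finite (injections D S)"
  unfolding injections_def by (simp add: finite_PiE)

lemma injections_empty: "injections {} S = {\<lambda>_. undefined}"
  by (auto simp: injections_def)

lemma injections_Diff_singleton: "injections D (S - {c}) = {y \<in> injections D S. c \<notin> y ` D}"
  by (auto simp: injections_def PiE_def Pi_def)

lemma fun_upd_injections:
  assumes "i \<notin> D" "y \<in> injections D S" "c \<in> S - y ` D"
  shows "y(i := c) \<in> injections (insert i D) S"
proof -
  have "inj_on (y(i := c)) D"
    using assms by (subst inj_on_cong[where g = y]) (auto simp: injections_def)
  then show ?thesis
    using assms by (auto simp: injections_def PiE_def extensional_def Pi_def)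
qed

lemma fun_upd_undefined_injections:
  assumes "i \<notin> D" "y \<in> injections (insert i D) S"
  shows "y(i := undefined) \<in> injections D (S - {y i})" "y(i := undefined) \<in> injections D S"
    "y i \<in> S - (y(i := undefined)) ` D"
proof -
  have *: "inj_on (y(i := undefined)) D"
    using assms by (subst inj_on_cong[where g = y]) (auto simp: injections_def)
  then show "y(i := undefined) \<in> injections D S"
    using assms by (auto simp: injections_def PiE_def extensional_def Pi_def)
  have "y i \<notin> y ` D"
    using assms by (auto simp: injections_def)
  then show 1: "y i \<in> S - (y(i := undefined)) ` D"
    using assms by (auto simp: injections_def)
  show "y(i := undefined) \<in> injections D (S - {y i})"
    unfolding injections_Diff_singleton using 1 \<open>y(i := undefined) \<in> injections D S\<close> by blast
qed

lemma fun_upd_undefined_eq: "y \<in> injections D S \<Longrightarrow> i \<notin> D \<Longrightarrow> y(i := undefined) = y"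
  by (auto simp: injections_def PiE_def extensional_def)

text \<open>Here the value at \<open>i\<close> is drawn last, from what the others left over, which
  describes resampling at \<open>i\<close>. In \<open>bij_betw_injections_first\<close> it is drawn
  first, which serves inductions on \<open>D\<close>.\<close>

lemma bij_betw_injections_last:
  assumes "i \<notin> D"
  shows "bij_betw (\<lambda>(y, c). y(i := c)) (Sigma (injections D S) (\<lambda>y. S - y ` D))
           (injections (insert i D) S)"
proof (intro bij_betw_byWitness[where f' = "\<lambda>y. (y(i := undefined), y i)"] ballI subsetI)
  fix z assume "z \<in> (\<lambda>(y, c). y(i := c)) ` Sigma (injections D S) (\<lambda>y. S - y ` D)"
  then show "z \<in> injections (insert i D) S"
    by (auto intro: fun_upd_injections[OF assms])
next
  fix z assume "z \<in> (\<lambda>y. (y(i := undefined), y i)) ` injections (insert i D) S"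
  then show "z \<in> Sigma (injections D S) (\<lambda>y. S - y ` D)"
    using fun_upd_undefined_injections[OF assms] by blast
qed (use assms in \<open>auto simp: fun_upd_undefined_eq\<close>)

lemma bij_betw_injections_first:
  assumes "i \<notin> D"
  shows "bij_betw (\<lambda>(c, y). y(i := c)) (Sigma S (\<lambda>c. injections D (S - {c})))
           (injections (insert i D) S)"
proof (intro bij_betw_byWitness[where f' = "\<lambda>y. (y i, y(i := undefined))"] ballI subsetI)
  fix z assume "z \<in> (\<lambda>(c, y). y(i := c)) ` Sigma S (\<lambda>c. injections D (S - {c}))"
  then show "z \<in> injections (insert i D) S"
    by (auto simp: injections_Diff_singleton intro: fun_upd_injections[OF assms])
next
  fix z assume "z \<in> (\<lambda>y. (y i, y(i := undefined))) ` injections (insert i D) S"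
  then show "z \<in> Sigma S (\<lambda>c. injections D (S - {c}))"
    using fun_upd_undefined_injections[OF assms] by blast
qed (use assms in \<open>auto simp: fun_upd_undefined_eq\<close>)

lemma card_diff_image_injections:
  assumes "finite D" "finite S" "y \<in> injections D S"
  shows "card (S - y ` D) = card S - card D"
  using assms by (subst card_Diff_subset) (auto simp: injections_def card_image)

lemma card_injections:
  assumes "finite D" "finite S"
  shows "card (injections D S) = (\<Prod>j<card D. card S - j)"
  using assms(1)
proof induction
  case (insert i D)
  have "card (injections (insert i D) S) = (\<Sum>y\<in>injections D S. card (S - y ` D))"
    using bij_betw_same_card[OF bij_betw_injections_last[OF insert(2)], of S] insert(1) assms(2)
    by (simp add: card_SigmaI finite_injections)
  also have "\<dots> = card (injections D S) * (card S - card D)"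
    using insert(1) assms(2) by (simp add: card_diff_image_injections)
  finally show ?case using insert by (simp add: mult.commute)
qed (simp add: injections_empty)

lemma mean_injections_last:
  assumes "i \<notin> D" "finite D" "finite S"
  shows "mean (injections (insert i D) S) f
    = mean (injections D S) (\<lambda>y. mean (S - y ` D) (\<lambda>c. f (y(i := c))))"
  using mean_bij_betw[OF bij_betw_injections_last[OF assms(1)], of S f] assms
    mean_Sigma[where N = "card S - card D" and X = "injections D S"
      and Y = "\<lambda>y. S - y ` D" and f = "\<lambda>x. f (case x of (y, c) \<Rightarrow> y(i := c))"]
  by (simp add: finite_injections card_diff_image_injections)

lemma injections_first:
  assumes "i \<notin> D" "finite D" "finite S"
  shows mean_injections_first: "mean (injections (insert i D) S) f
    = mean S (\<lambda>c. mean (injections D (S - {c})) (\<lambda>y. f (y(i := c))))"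
  and vari_injections_first: "vari (injections (insert i D) S) f
    = mean S (\<lambda>c. vari (injections D (S - {c})) (\<lambda>y. f (y(i := c))))
    + vari S (\<lambda>c. mean (injections D (S - {c})) (\<lambda>y. f (y(i := c))))"
proof -
  have *: "card (injections D (S - {c})) = (\<Prod>j<card D. card S - 1 - j)" if "c \<in> S" for c
    using that assms by (simp add: card_injections)
  show "mean (injections (insert i D) S) f
    = mean S (\<lambda>c. mean (injections D (S - {c})) (\<lambda>y. f (y(i := c))))"
    using mean_bij_betw[OF bij_betw_injections_first[OF assms(1)], of S f] assms
      mean_Sigma[of S "\<lambda>c. injections D (S - {c})", OF _ _ *]
    by (simp add: finite_injections)
  show "vari (injections (insert i D) S) f
    = mean S (\<lambda>c. vari (injections D (S - {c})) (\<lambda>y. f (y(i := c))))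
    + vari S (\<lambda>c. mean (injections D (S - {c})) (\<lambda>y. f (y(i := c))))"
    using vari_bij_betw[OF bij_betw_injections_first[OF assms(1)], of S f] assms
      vari_Sigma[of S "\<lambda>c. injections D (S - {c})", OF _ _ *]
    by (simp add: finite_injections)
qed

lemma injections_nonempty:
  assumes "finite D" "finite S" "card D \<le> card S"
  shows "injections D S \<noteq> {}"
proof -
  have "card (injections D S) > 0"
    using assms by (auto simp: card_injections prod_pos)
  then show ?thesis by auto
qed

text \<open>The functional \<open>\<Phi>\<close> sees the injection only through its values outside \<open>i\<close>, so the value at \<open>i\<close>
  can be averaged out.\<close>

lemma mean_injections_forget:
  assumes "i \<in> D" "finite D" "finite S" "card D \<le> card S"
  shows "mean (injections D S) (\<lambda>y. \<Phi> (S - y ` (D - {i})) (\<lambda>x. G (y(i := x))))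
    = mean (injections (D - {i}) S) (\<lambda>y. \<Phi> (S - y ` (D - {i})) (\<lambda>x. G (y(i := x))))"
proof -
  have D: "insert i (D - {i}) = D" using assms by auto
  have ne: "card (D - {i}) < card S" using assms by (metis card_Diff1_less order_less_le_trans)
  have "mean (injections D S) (\<lambda>y. \<Phi> (S - y ` (D - {i})) (\<lambda>x. G (y(i := x))))
    = mean (injections (D - {i}) S) (\<lambda>y. mean (S - y ` (D - {i}))
        (\<lambda>c. \<Phi> (S - (y(i := c)) ` (D - {i})) (\<lambda>x. G (y(i := x)))))"
    using mean_injections_last[of i "D - {i}" S
        "\<lambda>y. \<Phi> (S - y ` (D - {i})) (\<lambda>x. G (y(i := x)))", unfolded D] assms by simp
  also have "\<dots> = mean (injections (D - {i}) S) (\<lambda>y. \<Phi> (S - y ` (D - {i})) (\<lambda>x. G (y(i := x))))"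
  proof (rule mean_cong[OF refl])
    fix y assume y: "y \<in> injections (D - {i}) S"
    have "card (S - y ` (D - {i})) > 0"
      using card_diff_image_injections[OF _ _ y] ne assms by simp
    then have "S - y ` (D - {i}) \<noteq> {}" by (metis card.empty less_irrefl)
    moreover have "(y(i := c)) ` (D - {i}) = y ` (D - {i})" for c by auto
    ultimately show "mean (S - y ` (D - {i}))
        (\<lambda>c. \<Phi> (S - (y(i := c)) ` (D - {i})) (\<lambda>x. G (y(i := x))))
      = \<Phi> (S - y ` (D - {i})) (\<lambda>x. G (y(i := x)))"
      using assms by (simp add: mean_const)
  qed
  finally show ?thesis .
qed

text \<open>Stationarity: the value at \<open>i\<close> may be drawn last, and drawing it again
  changes nothing.\<close>

lemma mean_injections_resample:
  assumes "i \<in> D" "finite D" "finite S" "card D \<le> card S"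
  shows "mean (injections D S) (\<lambda>y. mean (S - y ` (D - {i})) (\<lambda>x. G (y(i := x))))
    = mean (injections D S) G"
proof -
  have D: "insert i (D - {i}) = D" using assms by auto
  show ?thesis
    using mean_injections_last[of i "D - {i}" S G, unfolded D] assms
    by (simp add: mean_injections_forget[OF assms, where \<Phi> = mean])
qed

text \<open>An injection avoids \<open>b\<close> or takes it at exactly one \<open>i\<close>; in the
  second case, erasing the value at \<open>i\<close> leaves an injection of \<open>D - {i}\<close>
  that avoids \<open>b\<close>.\<close>

lemma sum_injections_split:
  fixes G :: "('a \<Rightarrow> 'b) \<Rightarrow> real"
  assumes "finite D" "finite S" "b \<in> S"
  shows "(\<Sum>y\<in>injections D S. G y) = (\<Sum>y\<in>injections D (S - {b}). G y)
    + (\<Sum>i\<in>D. \<Sum>y\<in>injections (D - {i}) (S - {b}). G (y(i := b)))"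
proof -
  let ?P = "Sigma D (\<lambda>i. injections (D - {i}) (S - {b}))"
  have split: "injections D S = injections D (S - {b}) \<union> {y \<in> injections D S. b \<in> y ` D}"
    using assms by (auto simp: injections_def PiE_def Pi_def)
  have "(\<Sum>y\<in>injections D S. G y) = (\<Sum>y\<in>injections D (S - {b}). G y)
      + (\<Sum>y | y \<in> injections D S \<and> b \<in> y ` D. G y)"
    by (subst split, rule sum.union_disjoint)
      (use assms in \<open>auto simp: finite_injections\<close>, auto simp: injections_def PiE_def Pi_def)
  also have "bij_betw (\<lambda>(i, y). y(i := b)) ?P {y \<in> injections D S. b \<in> y ` D}"
  proof (intro bij_betw_byWitness[where
        f' = "\<lambda>y. (the_inv_into D y b, y(the_inv_into D y b := undefined))"] ballI subsetI)
    fix p assume p: "p \<in> ?P"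
    obtain i y where [simp]: "p = (i, y)" by (cases p)
    from p have i: "i \<in> D" and y: "y \<in> injections (D - {i}) (S - {b})" by auto
    have "y(i := b) \<in> injections D S"
      using fun_upd_injections[of i "D - {i}" y S b] y i assms(3)
      by (simp add: injections_Diff_singleton insert_absorb)
    then have "the_inv_into D (y(i := b)) b = i"
      using the_inv_into_f_f[of "y(i := b)" D i] i by (simp add: injections_def)
    then show "(\<lambda>y. (the_inv_into D y b, y(the_inv_into D y b := undefined)))
        ((\<lambda>(i, y). y(i := b)) p) = p"
      using fun_upd_undefined_eq[OF y] by simp
  next
    fix z assume "z \<in> {y \<in> injections D S. b \<in> y ` D}"
    then have "inj_on z D" "b \<in> z ` D" by (auto simp: injections_def)
    then have "z (the_inv_into D z b) = b" by (rule f_the_inv_into_f)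
    then show "(\<lambda>(i, y). y(i := b)) ((\<lambda>y. (the_inv_into D y b, y(the_inv_into D y b := undefined))) z) = z"
      by auto
  next
    fix z assume "z \<in> (\<lambda>(i, y). y(i := b)) ` ?P"
    then obtain i y where z: "z = y(i := b)" "i \<in> D" "y \<in> injections (D - {i}) (S - {b})" by auto
    then show "z \<in> {y \<in> injections D S. b \<in> y ` D}"
      using fun_upd_injections[of i "D - {i}" y S b] assms(3)
      by (auto simp: injections_Diff_singleton insert_absorb)
  next
    fix p assume "p \<in> (\<lambda>y. (the_inv_into D y b, y(the_inv_into D y b := undefined))) `
        {y \<in> injections D S. b \<in> y ` D}"
    then obtain z i where z: "z \<in> injections D S" "i \<in> D" "z i = b"
      "p = (the_inv_into D z b, z(the_inv_into D z b := undefined))" by auto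
    then have "the_inv_into D z b = i"
      by (auto simp: injections_def intro: the_inv_into_f_f)
    with z show "p \<in> ?P"
      using fun_upd_undefined_injections(1)[of i "D - {i}" z S] by (simp add: insert_absorb)
  qed
  then have "(\<Sum>y | y \<in> injections D S \<and> b \<in> y ` D. G y)
      = (\<Sum>i\<in>D. \<Sum>y\<in>injections (D - {i}) (S - {b}). G (y(i := b)))"
    using assms by (subst sum.Sigma) (auto simp: finite_injections sum.reindex_bij_betw[symmetric] case_prod_unfold)
  finally show ?thesis .
qed

section \<open>Contraction for injective colorings of a star\<close>

text \<open>With all other children fixed, \<open>U\<close> holds the colors they leave over and
  \<open>B\<close> those among them that the parent may take. The left side swaps two parent colors
  at one child; the right side resamples this child once the parent has taken \<open>c\<close>. Both
  are expressed by squared deviations from the mean over \<open>U\<close>.\<close>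

lemma sum_pairs_subset_le:
  fixes u :: "'a \<Rightarrow> real"
  assumes U: "finite U" "B \<subseteq> U" "card U = L + 1" and L: "3 \<le> L"
  shows "real L * (\<Sum>a\<in>B. \<Sum>b\<in>B. (u a - u b)\<^sup>2)
    \<le> 3 * (\<Sum>c\<in>B. \<Sum>x\<in>U - {c}. \<Sum>y\<in>U - {c}. (u x - u y)\<^sup>2)"
proof (cases "card B \<le> 1")
  case True
  have fB: "finite B" using U finite_subset by blast
  have "u a = u b" if "a \<in> B" "b \<in> B" for a b
    using that True card_le_Suc0_iff_eq[OF fB] by auto
  then have "(\<Sum>a\<in>B. \<Sum>b\<in>B. (u a - u b)\<^sup>2) = 0"
    by (intro sum.neutral ballI) (metis diff_self zero_power2)
  moreover have "0 \<le> (\<Sum>c\<in>B. \<Sum>x\<in>U - {c}. \<Sum>y\<in>U - {c}. (u x - u y)\<^sup>2)"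
    by (intro sum_nonneg) simp
  ultimately show ?thesis by simp
next
  case False
  have fB: "finite B" using U finite_subset by blast
  define m where "m = mean U u"
  define v where "v x = u x - m" for x
  define k where "k = real (card B)"
  define l where "l = real L"
  define QB where "QB = (\<Sum>x\<in>B. (v x)\<^sup>2)"
  define QU where "QU = (\<Sum>x\<in>U. (v x)\<^sup>2)"
  define s where "s = (\<Sum>x\<in>B. v x)"
  have v0: "(\<Sum>x\<in>U. v x) = 0"
    using U by (simp add: v_def m_def mean_def sum_subtractf)
  have sq: "(u x - u y)\<^sup>2 = (v x)\<^sup>2 + (v y)\<^sup>2 - 2 * (v x * v y)" for x y
    by (simp add: v_def power2_eq_square algebra_simps)
  have cU: "real (card U) = l + 1" using U by (simp add: l_def)
  have row: "(\<Sum>y\<in>U. (u x - u y)\<^sup>2) = (l + 1) * (v x)\<^sup>2 + QU" for x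
    using U(1) by (simp add: sq sum.distrib sum_subtractf sum_distrib_left[symmetric] v0 cU QU_def)
  have tot: "(\<Sum>x\<in>U. \<Sum>y\<in>U. (u x - u y)\<^sup>2) = 2 * (l + 1) * QU"
    using U(1) by (simp add: row sum.distrib sum_distrib_left[symmetric] cU QU_def[symmetric])
  have BB: "(\<Sum>a\<in>B. \<Sum>b\<in>B. (u a - u b)\<^sup>2) = 2 * k * QB - 2 * s\<^sup>2"
    by (simp add: sq sum.distrib sum_subtractf sum_distrib_left[symmetric] sum_distrib_right[symmetric]
        k_def[symmetric] QB_def[symmetric] s_def[symmetric] power2_eq_square[of s])
  have minus: "(\<Sum>x\<in>U - {c}. \<Sum>y\<in>U - {c}. (u x - u y)\<^sup>2)
      = 2 * (l + 1) * QU - 2 * ((l + 1) * (v c)\<^sup>2 + QU)" if "c \<in> B" for c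
  proof -
    have c: "c \<in> U" using that U by auto
    have "(\<Sum>y\<in>U - {c}. (u x - u y)\<^sup>2) = (l + 1) * (v x)\<^sup>2 + QU - (u x - u c)\<^sup>2" for x
      using sum.remove[OF U(1) c, of "\<lambda>y. (u x - u y)\<^sup>2"] row[of x] by simp
    moreover have "(\<Sum>x\<in>U - {c}. (l + 1) * (v x)\<^sup>2 + QU - (u x - u c)\<^sup>2)
        = (\<Sum>x\<in>U. (l + 1) * (v x)\<^sup>2 + QU) - ((l + 1) * (v c)\<^sup>2 + QU)
          - (\<Sum>x\<in>U. (u x - u c)\<^sup>2)"
      using sum.remove[OF U(1) c, of "\<lambda>x. (l + 1) * (v x)\<^sup>2 + QU - (u x - u c)\<^sup>2"]
      by (simp add: sum_subtractf)
    moreover have "(\<Sum>x\<in>U. (u x - u c)\<^sup>2) = (l + 1) * (v c)\<^sup>2 + QU"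
      using row[of c] by (simp add: power2_commute)
    ultimately show ?thesis using tot by (simp add: row)
  qed
  have rhs: "(\<Sum>c\<in>B. \<Sum>x\<in>U - {c}. \<Sum>y\<in>U - {c}. (u x - u y)\<^sup>2)
      = 2 * k * l * QU - 2 * (l + 1) * QB"
    by (simp add: minus sum_subtractf sum.distrib sum_distrib_left[symmetric]
        k_def[symmetric] QB_def[symmetric] algebra_simps)
  have QQ: "QB \<le> QU" unfolding QB_def QU_def using U by (intro sum_mono2) auto
  have QB0: "0 \<le> QB" unfolding QB_def by (simp add: sum_nonneg)
  have k2: "2 \<le> k" using False by (simp add: k_def)
  have l3: "3 \<le> l" using L by (simp add: l_def)
  \<comment> \<open>After dropping the term with \<open>s\<close> and using
    \<open>QB \<le> QU\<close>, the claim is \<open>2 * k * l \<ge> 3 * l + 3\<close>. For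
    \<open>k \<ge> 2\<close> it follows from \<open>l \<ge> 3\<close>, with equality at
    \<open>k = 2\<close>, \<open>l = 3\<close>.\<close>
  have "2 * l \<le> k * l" using k2 l3 by (intro mult_right_mono) auto
  then have "0 \<le> (2 * (k * l) - 3 * l - 3) * QB"
    using l3 QB0 by (intro mult_nonneg_nonneg) linarith+
  moreover have "3 * k * l * QB \<le> 3 * k * l * QU"
    using QQ k2 l3 by (intro mult_left_mono) auto
  moreover have "0 \<le> l * s\<^sup>2" using l3 by simp
  ultimately show ?thesis
    unfolding BB rhs l_def[symmetric] by (simp add: algebra_simps)
qed

lemma card_injections_remove:
  assumes "finite D" "finite S" "i \<in> D" "b \<in> S"
  shows "card (injections D S) = card S * card (injections (D - {i}) (S - {b}))"
proof -
  have "card D = Suc (card D - 1)"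
    using assms(1,3) by (metis card_Suc_Diff1 card_Diff_singleton)
  then show ?thesis
    using assms prod.lessThan_Suc_shift[of "\<lambda>j. card S - j" "card D - 1"]
    by (simp add: card_injections diff_diff_eq[symmetric] del: prod.lessThan_Suc)
qed

lemma square_sum_le:
  fixes z :: "'a \<Rightarrow> real"
  shows "(\<Sum>x\<in>S. z x)\<^sup>2 \<le> real (card S) * (\<Sum>x\<in>S. (z x)\<^sup>2)"
proof (cases "finite S \<and> S \<noteq> {}")
  case True
  then have "real (card S) > 0" by (simp add: card_gt_0_iff)
  then show ?thesis using mean_sq_le[of S z] by (simp add: mean_def field_simps power2_eq_square)
qed auto

lemma sum_injections_avoid:
  fixes H :: "('a \<Rightarrow> 'b) \<Rightarrow> 'b \<Rightarrow> real"
  assumes "finite D" "finite S" "finite A" "A \<subseteq> S"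
  shows "(\<Sum>c\<in>A. \<Sum>t\<in>injections D (S - {c}). H t c) = (\<Sum>t\<in>injections D S. \<Sum>c\<in>A - t ` D. H t c)"
proof -
  have *: "A - t ` D = {c \<in> A. c \<notin> t ` D}" for t by auto
  show ?thesis
    unfolding injections_Diff_singleton *
    by (rule sum.swap_restrict) (use assms in \<open>auto simp: finite_injections\<close>)
qed

text \<open>The uniform measures on injections avoiding \<open>a\<close> and avoiding \<open>b\<close> are coupled by replacing the
  color \<open>b\<close> with \<open>a\<close>; only a fraction \<open>card D / (card S - 1)\<close> of the injections is affected.\<close>

lemma mean_injections_diff_sq:
  fixes G :: "('a \<Rightarrow> 'b) \<Rightarrow> real"
  assumes fin: "finite D" "finite S" and ab: "a \<in> S" "b \<in> S" "a \<noteq> b" and card: "card D < card S"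
  defines "N \<equiv> real (card (injections D (S - {a})))"
  shows "(mean (injections D (S - {a})) G - mean (injections D (S - {b})) G)\<^sup>2
    \<le> real (card D) / (real (card S - 1) * N) *
        (\<Sum>i\<in>D. \<Sum>t\<in>injections (D - {i}) (S - {a} - {b}). (G (t(i := b)) - G (t(i := a)))\<^sup>2)"
    (is "_ \<le> _ * ?R")
proof -
  let ?P = "Sigma D (\<lambda>i. injections (D - {i}) (S - {a} - {b}))"
  have fP: "finite (injections (D - {i}) (S - {a} - {b}))" for i
    using fin by (simp add: finite_injections)
  have comm: "S - {b} - {a} = S - {a} - {b}" by auto
  have N': "real (card (injections D (S - {b}))) = N"
    using fin ab by (simp add: N_def card_injections)
  have "card (S - {a}) \<ge> card D" using fin ab card by simp
  then have Npos: "N > 0"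
    unfolding N_def using injections_nonempty[of D "S - {a}"] fin
    by (simp add: card_gt_0_iff finite_injections)
  have S1: "real (card S - 1) > 0"
    using card_mono[of S "{a, b}"] ab fin by simp
  have "mean (injections D (S - {a})) G - mean (injections D (S - {b})) G
      = ((\<Sum>y\<in>injections D (S - {a}). G y) - (\<Sum>y\<in>injections D (S - {b}). G y)) / N"
    unfolding mean_def N' N_def[symmetric] by (simp add: diff_divide_distrib)
  \<comment> \<open>Injections avoiding both colors occur in both sums and cancel; \<open>?P\<close>
    indexes the disagreements of the coupling.\<close>
  also have "(\<Sum>y\<in>injections D (S - {a}). G y) - (\<Sum>y\<in>injections D (S - {b}). G y)
      = (\<Sum>p\<in>?P. G ((snd p)(fst p := b)) - G ((snd p)(fst p := a)))"
    using sum_injections_split[of D "S - {a}" b G] sum_injections_split[of D "S - {b}" a G]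
      fin ab fP comm by (simp add: sum.Sigma case_prod_unfold sum_subtractf)
  finally have "(mean (injections D (S - {a})) G - mean (injections D (S - {b})) G)\<^sup>2
      = (\<Sum>p\<in>?P. G ((snd p)(fst p := b)) - G ((snd p)(fst p := a)))\<^sup>2 / N\<^sup>2"
    by (simp add: power_divide)
  \<comment> \<open>Cauchy-Schwarz over the disagreements alone: their relative size
    \<open>card ?P / N = card D / (card S - 1)\<close> is the contraction rate.\<close>
  also have "\<dots> \<le> real (card ?P) * (\<Sum>p\<in>?P. (G ((snd p)(fst p := b)) - G ((snd p)(fst p := a)))\<^sup>2) / N\<^sup>2"
    by (intro divide_right_mono square_sum_le) simp
  also have "(\<Sum>p\<in>?P. (G ((snd p)(fst p := b)) - G ((snd p)(fst p := a)))\<^sup>2) = ?R"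
    using fin fP by (simp add: sum.Sigma case_prod_unfold)
  also have "real (card ?P) * real (card S - 1) = real (card D) * N"
  proof -
    have "card (injections (D - {i}) (S - {a} - {b})) * (card S - 1) = card (injections D (S - {a}))"
      if "i \<in> D" for i
      using card_injections_remove[of D "S - {a}" i b] that fin ab by (simp add: mult.commute)
    then have "card ?P * (card S - 1) = card D * card (injections D (S - {a}))"
      using fin fP by (simp add: card_SigmaI sum_distrib_right)
    then show ?thesis unfolding N_def by (metis of_nat_mult)
  qed
  then have "real (card ?P) = real (card D) * N / real (card S - 1)"
    using S1 by (metis less_irrefl nonzero_mult_div_cancel_right)
  then have "real (card ?P) * ?R / N\<^sup>2 = real (card D) / (real (card S - 1) * N) * ?R"
    using Npos by (simp add: power2_eq_square)
  finally show ?thesis .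
qed

text \<open>The contraction when \<open>G\<close> does not depend on the parent color
  \<open>c\<close>. The coupling bounds the variance by swaps of two colors of \<open>A\<close> at
  one child, and \<open>sum_pairs_subset_le\<close> turns swaps into resampling of that
  child.\<close>

lemma vari_mean_injections_le:
  fixes G :: "('a \<Rightarrow> 'b) \<Rightarrow> real"
  assumes fin: "finite D" "finite S" and A: "A \<subseteq> S" "3 \<le> card A" and card: "card D + 3 \<le> card S"
  shows "vari A (\<lambda>c. mean (injections D (S - {c})) G)
    \<le> real (card D) / real (card S - 1) * (\<Sum>i\<in>D. mean A (\<lambda>c. mean (injections D (S - {c}))
        (\<lambda>y. vari (S - {c} - y ` (D - {i})) (\<lambda>x. G (y(i := x))))))"
proof -
  have fA: "finite A" using A fin finite_subset by blast
  obtain c0 where c0: "c0 \<in> A" using A by fastforce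
  define N where "N = real (card (injections D (S - {c0})))"
  define k where "k = real (card A)"
  define L where "L = card S - card D"
  define l where "l = real L"
  have k3: "3 \<le> k" and l3: "3 \<le> l" and L3: "3 \<le> L" using A card by (auto simp: k_def l_def L_def)
  have N: "real (card (injections D (S - {c}))) = N" if "c \<in> A" for c
    using that c0 fin A by (auto simp: N_def card_injections subset_iff)
  have Npos: "N > 0"
    unfolding N_def using injections_nonempty[of D "S - {c0}"] fin card c0 A
    by (auto simp: card_gt_0_iff finite_injections subset_iff)
  define K where "K = real (card D) / (real (card S - 1) * N)"
  have K0: "0 \<le> K" unfolding K_def using Npos by simp
  \<comment> \<open>\<open>W\<close> collects the swaps that the coupling produces, \<open>Z\<close>
    the pairs that appear in the variance of child \<open>i\<close> given the parent color
    \<open>c\<close>.\<close>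
  define W where "W i t = (\<Sum>a\<in>A - t ` (D - {i}). \<Sum>b\<in>A - t ` (D - {i}). (G (t(i := a)) - G (t(i := b)))\<^sup>2)" for i t
  define Z where "Z i t = (\<Sum>c\<in>A - t ` (D - {i}). \<Sum>x\<in>S - t ` (D - {i}) - {c}. \<Sum>y\<in>S - t ` (D - {i}) - {c}. (G (t(i := x)) - G (t(i := y)))\<^sup>2)" for i t
  have WZ: "l * W i t \<le> 3 * Z i t" if "i \<in> D" "t \<in> injections (D - {i}) S" for i t
    unfolding W_def Z_def l_def
  proof (rule sum_pairs_subset_le)
    show "card (S - t ` (D - {i})) = L + 1"
      using card_diff_image_injections[of "D - {i}" S t] that fin card
      by (auto simp: L_def card_Diff_singleton Suc_diff_le)
        (metis Suc_diff_le Suc_pred add_leD1 card_gt_0_iff diff_Suc_Suc empty_iff le_SucI)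
  qed (use A fin L3 in auto)

  have "vari A (\<lambda>c. mean (injections D (S - {c})) G)
    = (\<Sum>a\<in>A. \<Sum>b\<in>A. (mean (injections D (S - {a})) G - mean (injections D (S - {b})) G)\<^sup>2) / (2 * k\<^sup>2)"
    unfolding vari_pairs k_def ..
  also have "\<dots> \<le> (\<Sum>a\<in>A. \<Sum>b\<in>A. K *
     (\<Sum>i\<in>D. \<Sum>t\<in>injections (D - {i}) (S - {a} - {b}). (G (t(i := b)) - G (t(i := a)))\<^sup>2)) / (2 * k\<^sup>2)"
  proof (intro divide_right_mono sum_mono)
    fix a b assume ab: "a \<in> A" "b \<in> A"
    show "(mean (injections D (S - {a})) G - mean (injections D (S - {b})) G)\<^sup>2 \<le> K *
     (\<Sum>i\<in>D. \<Sum>t\<in>injections (D - {i}) (S - {a} - {b}). (G (t(i := b)) - G (t(i := a)))\<^sup>2)"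
    proof (cases "a = b")
      case True
      then show ?thesis using K0 by (simp add: sum_nonneg)
    next
      case False
      then show ?thesis
        using mean_injections_diff_sq[of D S a b G] fin ab A card by (auto simp: N[symmetric] K_def subset_iff)
    qed
  qed simp
  also have "\<dots> = K / (2 * k\<^sup>2) *
     (\<Sum>i\<in>D. \<Sum>a\<in>A. \<Sum>b\<in>A. \<Sum>t\<in>injections (D - {i}) (S - {a} - {b}). (G (t(i := b)) - G (t(i := a)))\<^sup>2)"
    by (simp add: sum_distrib_left[symmetric] sum.swap[of _ D])
  also have "(\<Sum>i\<in>D. \<Sum>a\<in>A. \<Sum>b\<in>A. \<Sum>t\<in>injections (D - {i}) (S - {a} - {b}). (G (t(i := b)) - G (t(i := a)))\<^sup>2)
     = (\<Sum>i\<in>D. \<Sum>t\<in>injections (D - {i}) S. W i t)"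
  proof (rule sum.cong[OF refl])
    fix i assume "i \<in> D"
    \<comment> \<open>The vanishing terms with \<open>a = b\<close> are dropped so that
      \<open>A - {a}\<close> lies in the palette \<open>S - {a}\<close>; they return in
      \<open>W\<close>.\<close>
    have "(\<Sum>a\<in>A. \<Sum>b\<in>A. \<Sum>t\<in>injections (D - {i}) (S - {a} - {b}). (G (t(i := b)) - G (t(i := a)))\<^sup>2)
      = (\<Sum>a\<in>A. \<Sum>b\<in>A - {a}. \<Sum>t\<in>injections (D - {i}) (S - {a} - {b}). (G (t(i := b)) - G (t(i := a)))\<^sup>2)"
      using fA by (intro sum.cong refl sum.mono_neutral_right) auto
    also have "\<dots> = (\<Sum>a\<in>A. \<Sum>t\<in>injections (D - {i}) (S - {a}). \<Sum>b\<in>A - {a} - t ` (D - {i}). (G (t(i := b)) - G (t(i := a)))\<^sup>2)"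
      using A fin fA by (intro sum.cong refl sum_injections_avoid) auto
    also have "\<dots> = (\<Sum>t\<in>injections (D - {i}) S. \<Sum>a\<in>A - t ` (D - {i}). \<Sum>b\<in>A - {a} - t ` (D - {i}). (G (t(i := b)) - G (t(i := a)))\<^sup>2)"
      using A fin fA by (intro sum_injections_avoid) auto
    also have "\<dots> = (\<Sum>t\<in>injections (D - {i}) S. W i t)"
      unfolding W_def using fA
      by (intro sum.cong refl sum.mono_neutral_cong_left) (auto simp: power2_commute)
    finally show "(\<Sum>a\<in>A. \<Sum>b\<in>A. \<Sum>t\<in>injections (D - {i}) (S - {a} - {b}). (G (t(i := b)) - G (t(i := a)))\<^sup>2)
      = (\<Sum>t\<in>injections (D - {i}) S. W i t)" .
  qed
  also have "K / (2 * k\<^sup>2) * (\<Sum>i\<in>D. \<Sum>t\<in>injections (D - {i}) S. W i t)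
     \<le> K / (2 * k\<^sup>2) * (\<Sum>i\<in>D. \<Sum>t\<in>injections (D - {i}) S. k / l * Z i t)"
  proof (intro mult_left_mono sum_mono)
    fix i t assume it: "i \<in> D" "t \<in> injections (D - {i}) S"
    have "0 \<le> Z i t" unfolding Z_def by (simp add: sum_nonneg)
    \<comment> \<open>The factor 3 of \<open>WZ\<close> is swallowed by \<open>k = card A\<close>,
      which the normalization cancels, so the coupling rate is kept exactly.\<close>
    then have "l * W i t \<le> k * Z i t" using WZ[OF it] k3 by (meson mult_right_mono order_trans)
    then show "W i t \<le> k / l * Z i t" using l3 by (simp add: field_simps)
  qed (use K0 in simp)
  also have "\<dots> = real (card D) / real (card S - 1) * (\<Sum>i\<in>D. (\<Sum>t\<in>injections (D - {i}) S. Z i t) / (2 * k * N * l))"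
    using k3 l3 Npos
    by (simp add: K_def sum_distrib_left[symmetric] sum_divide_distrib[symmetric] power2_eq_square)
  also have "(\<Sum>i\<in>D. (\<Sum>t\<in>injections (D - {i}) S. Z i t) / (2 * k * N * l))
     = (\<Sum>i\<in>D. mean A (\<lambda>c. mean (injections D (S - {c}))
        (\<lambda>y. vari (S - {c} - y ` (D - {i})) (\<lambda>x. G (y(i := x))))))"
  proof (rule sum.cong[OF refl])
    fix i assume i: "i \<in> D"
    have cD: "card (D - {i}) = card D - 1" "card D > 0" using i fin by (auto simp: card_gt_0_iff)
    let ?H = "\<lambda>t c. \<Sum>x\<in>S - t ` (D - {i}) - {c}. \<Sum>y\<in>S - t ` (D - {i}) - {c}. (G (t(i := x)) - G (t(i := y)))\<^sup>2"
    have "mean (injections D (S - {c})) (\<lambda>y. vari (S - {c} - y ` (D - {i})) (\<lambda>x. G (y(i := x))))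
       = (\<Sum>t\<in>injections (D - {i}) (S - {c}). ?H t c) / (2 * N * l)" if c: "c \<in> A" for c
    proof -
      have cS: "c \<in> S" using c A by auto
      have D: "insert i (D - {i}) = D" using i by auto
      have "mean (injections D (S - {c})) (\<lambda>y. vari (S - {c} - y ` (D - {i})) (\<lambda>x. G (y(i := x))))
       = mean (injections (D - {i}) (S - {c})) (\<lambda>y. vari (S - {c} - y ` (D - {i})) (\<lambda>x. G (y(i := x))))"
        using i fin card cS by (intro mean_injections_forget) auto
      also have "\<dots> = mean (injections (D - {i}) (S - {c})) (\<lambda>t. ?H t c / (2 * l\<^sup>2))"
      proof (rule mean_cong[OF refl])
        fix t assume "t \<in> injections (D - {i}) (S - {c})"
        then have "card (S - {c} - t ` (D - {i})) = L"
          using card_diff_image_injections[of "D - {i}" "S - {c}" t] fin cS card cD by (simp add: L_def)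
        moreover have "S - {c} - t ` (D - {i}) = S - t ` (D - {i}) - {c}" by auto
        ultimately show "vari (S - {c} - t ` (D - {i})) (\<lambda>x. G (t(i := x))) = ?H t c / (2 * l\<^sup>2)"
          unfolding vari_pairs by (simp add: l_def)
      qed
      also have "\<dots> = (\<Sum>t\<in>injections (D - {i}) (S - {c}). ?H t c) / (2 * l\<^sup>2 * real (card (injections (D - {i}) (S - {c}))))"
        by (simp add: mean_def sum_divide_distrib[symmetric])
      also have "2 * l\<^sup>2 * real (card (injections (D - {i}) (S - {c}))) = 2 * N * l"
      proof -
        have "card (injections D (S - {c})) = card (injections (D - {i}) (S - {c})) * L"
          using card_injections[of "D - {i}" "S - {c}"] card_injections[of D "S - {c}"] cD fin cS
            prod.lessThan_Suc[of "\<lambda>j. card (S - {c}) - j" "card D - 1"] by (simp add: L_def)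
        then have "N = real (card (injections (D - {i}) (S - {c}))) * l"
          using N[OF c] by (simp add: l_def)
        then show ?thesis by (simp add: power2_eq_square)
      qed
      finally show ?thesis .
    qed
    then have "mean A (\<lambda>c. mean (injections D (S - {c}))
        (\<lambda>y. vari (S - {c} - y ` (D - {i})) (\<lambda>x. G (y(i := x)))))
      = mean A (\<lambda>c. (\<Sum>t\<in>injections (D - {i}) (S - {c}). ?H t c) / (2 * N * l))"
      by (intro mean_cong) auto
    also have "\<dots> = (\<Sum>c\<in>A. \<Sum>t\<in>injections (D - {i}) (S - {c}). ?H t c) / (2 * k * N * l)"
      by (simp add: mean_def sum_divide_distrib[symmetric] k_def)
    also have "(\<Sum>c\<in>A. \<Sum>t\<in>injections (D - {i}) (S - {c}). ?H t c) = (\<Sum>t\<in>injections (D - {i}) S. Z i t)"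
      unfolding Z_def using A fA fin by (intro sum_injections_avoid) auto
    finally show "(\<Sum>t\<in>injections (D - {i}) S. Z i t) / (2 * k * N * l)
      = mean A (\<lambda>c. mean (injections D (S - {c}))
        (\<lambda>y. vari (S - {c} - y ` (D - {i})) (\<lambda>x. G (y(i := x)))))" ..
  qed
  finally show ?thesis .
qed

text \<open>The factor \<open>card B\<close> is written as a sum of constants to match the inner
  sums over the parent color in \<open>EE_sum\<close>.\<close>

lemma sum_sq_dev_eq: "finite B \<Longrightarrow> (\<Sum>x\<in>B. (f x - mean B f)\<^sup>2) = (\<Sum>x\<in>B. vari B f)"
  by (cases "B = {}") (simp_all add: vari_def mean_def[of B "\<lambda>x. (f x - mean B f)\<^sup>2"])

text \<open>A function \<open>F\<close> of the color \<open>c\<close> of an edge and of the coloring \<open>y\<close> of the edges below it is split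
  into its average over \<open>c\<close>, to which \<open>vari_mean_injections_le\<close> applies, and a
  remainder that is controlled by resampling \<open>c\<close>.\<close>

lemma vari_mean_injections_dep_le:
  fixes F :: "'b \<Rightarrow> ('a \<Rightarrow> 'b) \<Rightarrow> real"
  assumes fin: "finite D" "finite S" and A: "A \<subseteq> S" "3 \<le> card A" and card: "card D + 3 \<le> card S"
    and e: "e > 0"
  shows "vari A (\<lambda>c. mean (injections D (S - {c})) (F c))
    \<le> (1 + e)\<^sup>2 * (real (card D) / real (card S - 1)) *
        (\<Sum>i\<in>D. mean A (\<lambda>c. mean (injections D (S - {c}))
          (\<lambda>y. vari (S - {c} - y ` (D - {i})) (\<lambda>x. F c (y(i := x))))))
      + ((1 + e) * (1 + 1 / e) * (real (card D) / real (card S - 1)) * real (card D) + (1 + 1 / e)) *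
        mean A (\<lambda>c. mean (injections D (S - {c})) (\<lambda>y. vari (A - y ` D) (\<lambda>x. F x y)))"
proof -
  have fA: "finite A" using A(1) fin(2) by (rule finite_subset)
  define EE where "EE \<phi> = mean A (\<lambda>c. mean (injections D (S - {c})) (\<phi> c))"
    for \<phi> :: "'b \<Rightarrow> ('a \<Rightarrow> 'b) \<Rightarrow> real"
  define r where "r = real (card D) / real (card S - 1)"
  define g where "g y = mean (A - y ` D) (\<lambda>x. F x y)" for y
  define H where "H c y = F c y - g y" for c y
  define Qe where "Qe = EE (\<lambda>c y. vari (A - y ` D) (\<lambda>x. F x y))"
  define Q where "Q i = EE (\<lambda>c y. vari (S - {c} - y ` (D - {i})) (\<lambda>x. F c (y(i := x))))" for i
  have r0: "0 \<le> r" unfolding r_def by simp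
  have e1: "0 < 1 + e" "0 < 1 + 1 / e" using e by (auto intro: add_pos_pos)
  have EE_mono: "EE \<phi> \<le> EE \<psi>" if "\<And>c y. \<phi> c y \<le> \<psi> c y" for \<phi> \<psi>
    unfolding EE_def by (intro mean_mono that)
  have EE_lin: "EE (\<lambda>c y. s * \<phi> c y + t * \<psi> c y) = s * EE \<phi> + t * EE \<psi>" for \<phi> \<psi> s t
    unfolding EE_def by (simp add: mean_add mean_cmult)
  obtain c0 where c0: "c0 \<in> A" using A(2) by fastforce
  define N where "N = real (card (injections D (S - {c0})))"
  have N: "real (card (injections D (S - {c}))) = N" if "c \<in> A" for c
    using that c0 fin A by (auto simp: N_def card_injections subset_iff)
  have EE_sum: "EE \<phi> = (\<Sum>y\<in>injections D S. \<Sum>c\<in>A - y ` D. \<phi> c y) / (N * real (card A))" for \<phi>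
  proof -
    have "EE \<phi> = (\<Sum>c\<in>A. \<Sum>y\<in>injections D (S - {c}). \<phi> c y) / (N * real (card A))"
      unfolding EE_def mean_def by (simp add: N sum_divide_distrib[symmetric] cong: sum.cong)
    also have "(\<Sum>c\<in>A. \<Sum>y\<in>injections D (S - {c}). \<phi> c y)
        = (\<Sum>y\<in>injections D S. \<Sum>c\<in>A - y ` D. \<phi> c y)"
      using fin fA A(1) by (rule sum_injections_avoid)
    finally show ?thesis .
  qed
  have HH: "EE (\<lambda>c y. (H c y)\<^sup>2) = Qe"
    unfolding Qe_def EE_sum H_def g_def using fA by (subst sum_sq_dev_eq) auto
  have "vari A (\<lambda>c. mean (injections D (S - {c})) (F c))
      = vari A (\<lambda>c. mean (injections D (S - {c})) g + mean (injections D (S - {c})) (H c))"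
    by (simp add: mean_add[symmetric]) (simp add: H_def)
  also have "\<dots> \<le> (1 + e) * vari A (\<lambda>c. mean (injections D (S - {c})) g)
      + (1 + 1 / e) * vari A (\<lambda>c. mean (injections D (S - {c})) (H c))"
    by (rule vari_add_le[OF e])
  also have "vari A (\<lambda>c. mean (injections D (S - {c})) (H c)) \<le> Qe"
  proof -
    have "vari A (\<lambda>c. mean (injections D (S - {c})) (H c))
        \<le> mean A (\<lambda>c. (mean (injections D (S - {c})) (H c))\<^sup>2)"
      by (rule vari_le_mean_sq)
    also have "\<dots> \<le> EE (\<lambda>c y. (H c y)\<^sup>2)"
      unfolding EE_def by (intro mean_mono mean_sq_le)
    finally show ?thesis unfolding HH .
  qed
  also have "vari A (\<lambda>c. mean (injections D (S - {c})) g) \<le> r * (\<Sum>i\<in>D. (1 + e) * Q i + (1 + 1 / e) * Qe)"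
  proof -
    have "vari A (\<lambda>c. mean (injections D (S - {c})) g)
        \<le> r * (\<Sum>i\<in>D. EE (\<lambda>c y. vari (S - {c} - y ` (D - {i})) (\<lambda>x. g (y(i := x)))))"
      unfolding r_def EE_def by (rule vari_mean_injections_le[OF fin A card])
    also have "\<dots> \<le> r * (\<Sum>i\<in>D. (1 + e) * Q i + (1 + 1 / e) * Qe)"
    proof (intro mult_left_mono sum_mono r0)
      fix i assume i: "i \<in> D"
      \<comment> \<open>Here \<open>g = F c - H c\<close>; the variance of \<open>H c\<close> is
        bounded by its second moment, whose average is \<open>Qe\<close> because resampling
        \<open>i\<close> is stationary.\<close>
      have "vari B (\<lambda>x. g (y(i := x))) \<le> (1 + e) * vari B (\<lambda>x. F c (y(i := x)))
          + (1 + 1 / e) * mean B (\<lambda>x. (H c (y(i := x)))\<^sup>2)" for B c y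
      proof -
        have "vari B (\<lambda>x. g (y(i := x))) = vari B (\<lambda>x. F c (y(i := x)) + - H c (y(i := x)))"
          by (simp add: H_def)
        also have "\<dots> \<le> (1 + e) * vari B (\<lambda>x. F c (y(i := x)))
            + (1 + 1 / e) * vari B (\<lambda>x. - H c (y(i := x)))"
          by (rule vari_add_le[OF e])
        also have "vari B (\<lambda>x. - H c (y(i := x))) \<le> mean B (\<lambda>x. (H c (y(i := x)))\<^sup>2)"
          using vari_le_mean_sq[of B "\<lambda>x. - H c (y(i := x))"] by simp
        finally show ?thesis using e1 by (simp add: fun_upd_def)
      qed
      then have "EE (\<lambda>c y. vari (S - {c} - y ` (D - {i})) (\<lambda>x. g (y(i := x))))
        \<le> (1 + e) * Q i
          + (1 + 1 / e) * EE (\<lambda>c y. mean (S - {c} - y ` (D - {i})) (\<lambda>x. (H c (y(i := x)))\<^sup>2))"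
        unfolding Q_def EE_lin[symmetric] by (intro EE_mono)
      also have "EE (\<lambda>c y. mean (S - {c} - y ` (D - {i})) (\<lambda>x. (H c (y(i := x)))\<^sup>2))
          = EE (\<lambda>c y. (H c y)\<^sup>2)"
        unfolding EE_def
      proof (rule mean_cong[OF refl])
        fix c assume "c \<in> A"
        then have "card D \<le> card (S - {c})" using card A(1) fin by (auto simp: subset_iff)
        with i fin show "mean (injections D (S - {c}))
            (\<lambda>y. mean (S - {c} - y ` (D - {i})) (\<lambda>x. (H c (y(i := x)))\<^sup>2))
          = mean (injections D (S - {c})) (\<lambda>y. (H c y)\<^sup>2)"
          by (intro mean_injections_resample[where G = "\<lambda>y. (H c y)\<^sup>2"]) auto
      qed
      finally show "EE (\<lambda>c y. vari (S - {c} - y ` (D - {i})) (\<lambda>x. g (y(i := x))))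
          \<le> (1 + e) * Q i + (1 + 1 / e) * Qe"
        unfolding HH .
    qed
    finally show ?thesis .
  qed
  also have "(\<Sum>i\<in>D. (1 + e) * Q i + (1 + 1 / e) * Qe)
      = (1 + e) * (\<Sum>i\<in>D. Q i) + real (card D) * ((1 + 1 / e) * Qe)"
    by (simp add: sum.distrib sum_distrib_left)
  also have "(1 + e) * (r * \<dots>) + (1 + 1 / e) * Qe
      = (1 + e)\<^sup>2 * r * (\<Sum>i\<in>D. Q i) + ((1 + e) * (1 + 1 / e) * r * real (card D) + (1 + 1 / e)) * Qe"
    by (simp add: power2_eq_square algebra_simps)
  finally show ?thesis
    using e1 unfolding r_def Q_def Qe_def EE_def by simp
qed

text \<open>Induction on \<open>D\<close> with total variance: the color of the new element
  \<open>j\<close> plays the parent, with \<open>A = S\<close> and \<open>e = 1\<close>. Only a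
  finite constant matters here, so the rate is bounded by 1; the factor \<open>(1 + 1)^2\<close> is
  why each element adds 4.\<close>

lemma vari_injections_le:
  fixes F :: "('a \<Rightarrow> 'b) \<Rightarrow> real"
  assumes "finite D" "finite S" "card D + 2 \<le> card S"
  shows "vari (injections D S) F \<le> 4 * real (card D) *
    (\<Sum>i\<in>D. mean (injections D S) (\<lambda>y. vari (S - y ` (D - {i})) (\<lambda>x. F (y(i := x)))))"
  using assms
proof (induction D arbitrary: S F rule: finite_induct)
  case empty
  then show ?case by (simp add: injections_empty vari_def mean_def)
next
  case (insert j D)
  define d where "d = real (card D)"
  define Q where "Q i = mean (injections (insert j D) S)
    (\<lambda>y. vari (S - y ` (insert j D - {i})) (\<lambda>x. F (y(i := x))))" for i
  have S: "card D + 3 \<le> card S" using insert by simp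
  have Q0: "0 \<le> Q i" for i unfolding Q_def by (intro mean_nonneg vari_nonneg)
  have Qi: "Q i = mean S (\<lambda>c. mean (injections D (S - {c}))
      (\<lambda>y. vari (S - {c} - y ` (D - {i})) (\<lambda>x. F (y(i := x, j := c)))))" if "i \<in> D" for i
  proof -
    have ij: "i \<noteq> j" using that insert by auto
    have "S - (y(j := c)) ` (insert j D - {i}) = S - {c} - y ` (D - {i})" for y and c :: 'b
      using insert.hyps ij by auto
    moreover have "y(j := c, i := x) = y(i := x, j := c)" for y :: "'a \<Rightarrow> 'b" and c x
      using ij by (rule fun_upd_twist[symmetric])
    ultimately show ?thesis
      unfolding Q_def mean_injections_first[OF insert.hyps(2,1) insert.prems(1)] by (simp only:)
  qed
  have Qj: "Q j = mean S (\<lambda>c. mean (injections D (S - {c})) (\<lambda>y. vari (S - y ` D) (\<lambda>x. F (y(j := x)))))"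
  proof -
    have "S - (y(j := c)) ` (insert j D - {j}) = S - y ` D" for y and c :: 'b
      using insert.hyps by auto
    then show ?thesis
      unfolding Q_def mean_injections_first[OF insert.hyps(2,1) insert.prems(1)]
      by (simp only: fun_upd_upd)
  qed
  have "vari (injections (insert j D) S) F
    = mean S (\<lambda>c. vari (injections D (S - {c})) (\<lambda>y. F (y(j := c))))
      + vari S (\<lambda>c. mean (injections D (S - {c})) (\<lambda>y. F (y(j := c))))"
    using insert by (intro vari_injections_first) auto
  also have "mean S (\<lambda>c. vari (injections D (S - {c})) (\<lambda>y. F (y(j := c))))
    \<le> mean S (\<lambda>c. 4 * d * (\<Sum>i\<in>D. mean (injections D (S - {c}))
        (\<lambda>y. vari (S - {c} - y ` (D - {i})) (\<lambda>x. F (y(i := x, j := c))))))"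
    unfolding d_def using insert S by (intro mean_mono insert.IH) auto
  also have "\<dots> = 4 * d * (\<Sum>i\<in>D. Q i)"
    by (simp add: mean_cmult mean_sum Qi)
  also have "vari S (\<lambda>c. mean (injections D (S - {c})) (\<lambda>y. F (y(j := c))))
    \<le> (1 + 1)\<^sup>2 * (d / real (card S - 1)) * (\<Sum>i\<in>D. Q i)
      + ((1 + 1) * (1 + 1 / 1) * (d / real (card S - 1)) * d + (1 + 1 / 1)) * Q j"
    using vari_mean_injections_dep_le[of D S S 1 "\<lambda>c y. F (y(j := c))"] insert S
    by (simp add: Qi Qj d_def)
  also have "\<dots> \<le> 4 * (\<Sum>i\<in>D. Q i) + (4 * d + 2) * Q j"
  proof -
    have r: "d / real (card S - 1) \<le> 1" using S by (simp add: d_def)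
    have "(1 + 1)\<^sup>2 * (d / real (card S - 1)) * (\<Sum>i\<in>D. Q i) \<le> 4 * (\<Sum>i\<in>D. Q i)"
      using r by (intro mult_right_mono) (auto intro: sum_nonneg Q0)
    moreover have "d / real (card S - 1) * d \<le> 1 * d"
      using r by (intro mult_right_mono) (auto simp: d_def)
    then have "((1 + 1) * (1 + 1 / 1) * (d / real (card S - 1)) * d + (1 + 1 / 1)) * Q j \<le> (4 * d + 2) * Q j"
      by (intro mult_right_mono Q0) auto
    ultimately show ?thesis by (rule add_mono)
  qed
  also have "4 * d * (\<Sum>i\<in>D. Q i) + \<dots> \<le> 4 * (d + 1) * (\<Sum>i\<in>insert j D. Q i)"
    using insert Q0[of j] by (simp add: algebra_simps)
  finally show ?case
    using insert.hyps by (simp add: Q_def d_def add.commute fun_upd_def)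
qed

section \<open>Edge colorings and resampling one edge\<close>

declare One_nat_def [simp del]

definition available :: "'v set set \<Rightarrow> nat \<Rightarrow> ('v set \<Rightarrow> nat) \<Rightarrow> 'v set \<Rightarrow> nat set" where
  "available E q \<sigma> e = {1..q} - \<sigma> ` {f \<in> E. adjacent_edges e f}"

text \<open>The contribution of \<open>e\<close> to the Dirichlet form of the heat-bath dynamics, in
  which the new color is drawn from the available ones only.\<close>

definition local_vari :: "'v set set \<Rightarrow> nat \<Rightarrow> 'v set \<Rightarrow> (('v set \<Rightarrow> nat) \<Rightarrow> real) \<Rightarrow> real" where
  "local_vari E q e f
    = mean (edge_colorings E q) (\<lambda>\<sigma>. vari (available E q \<sigma> e) (\<lambda>c. f (\<sigma>(e := c))))"

lemma finite_available: "finite (available E q \<sigma> e)"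
  unfolding available_def by simp

lemma local_vari_nonneg: "0 \<le> local_vari E q e f"
  unfolding local_vari_def by (intro mean_nonneg vari_nonneg)

lemma adjacent_edges_sym: "adjacent_edges e f \<longleftrightarrow> adjacent_edges f e"
  unfolding adjacent_edges_def by auto

lemma finite_edge_colorings: "finite E \<Longrightarrow> finite (edge_colorings E q)"
  unfolding edge_colorings_def by (simp add: finite_PiE)

lemma available_self: "\<sigma> \<in> edge_colorings E q \<Longrightarrow> e \<in> E \<Longrightarrow> \<sigma> e \<in> available E q \<sigma> e"
  unfolding available_def edge_colorings_def by (auto simp: PiE_def Pi_def)

lemma available_fun_upd: "available E q (\<sigma>(e := c)) e = available E q \<sigma> e"
proof -
  have "(\<sigma>(e := c)) ` {f \<in> E. adjacent_edges e f} = \<sigma> ` {f \<in> E. adjacent_edges e f}"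
    by (intro image_cong) (auto simp: adjacent_edges_def)
  then show ?thesis unfolding available_def by simp
qed

lemma fun_upd_edge_colorings:
  assumes "\<sigma> \<in> edge_colorings E q" "e \<in> E" "c \<in> available E q \<sigma> e"
  shows "\<sigma>(e := c) \<in> edge_colorings E q"
proof -
  have "\<sigma>(e := c) \<in> E \<rightarrow>\<^sub>E {1..q}"
    using assms unfolding edge_colorings_def available_def PiE_def extensional_def Pi_def by auto
  moreover have "(\<sigma>(e := c)) g \<noteq> (\<sigma>(e := c)) f" if "g \<in> E" "f \<in> E" "adjacent_edges g f" for f g
  proof -
    have "c \<noteq> \<sigma> h" if "h \<in> E" "adjacent_edges e h" for h
      using that assms(3) unfolding available_def by auto
    moreover have "\<sigma> g \<noteq> \<sigma> f" "g \<noteq> f"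
      using that assms(1) unfolding edge_colorings_def adjacent_edges_def by auto
    ultimately show ?thesis
      using that adjacent_edges_sym[of e g] by (cases "g = e"; cases "f = e") force+
  qed
  ultimately show ?thesis unfolding edge_colorings_def by blast
qed

text \<open>Stationarity of resampling: exchanging the old and the new color of \<open>e\<close> is
  an involution on pairs of a coloring and an available color, and it preserves the set of available
  colors.\<close>

lemma sum_resample:
  fixes G :: "('v set \<Rightarrow> nat) \<Rightarrow> real"
  assumes "finite E" "e \<in> E"
  shows "(\<Sum>\<sigma>\<in>edge_colorings E q. mean (available E q \<sigma> e) (\<lambda>c. G (\<sigma>(e := c))))
    = (\<Sum>\<sigma>\<in>edge_colorings E q. G \<sigma>)"
proof -
  let ?O = "edge_colorings E q" and ?A = "\<lambda>\<sigma>. available E q \<sigma> e"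
  let ?swap = "\<lambda>(\<sigma>, c). (\<sigma>(e := c), \<sigma> e)"
  have fin: "finite ?O" using assms(1) by (rule finite_edge_colorings)
  have bij: "bij_betw ?swap (Sigma ?O ?A) (Sigma ?O ?A)"
    by (rule bij_betw_byWitness[where f' = ?swap])
      (auto simp: available_fun_upd available_self assms(2) intro: fun_upd_edge_colorings assms(2))
  have "(\<Sum>\<sigma>\<in>?O. mean (?A \<sigma>) (\<lambda>c. G (\<sigma>(e := c))))
      = (\<Sum>p\<in>Sigma ?O ?A. G ((fst p)(e := snd p)) / real (card (?A (fst p))))"
    using fin by (simp add: finite_available mean_def sum_divide_distrib case_prod_unfold sum.Sigma)
  also have "\<dots> = (\<Sum>p\<in>Sigma ?O ?A. G ((fst (?swap p))(e := snd (?swap p))) / real (card (?A (fst (?swap p)))))"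
    by (rule sum.reindex_bij_betw[OF bij, symmetric])
  also have "\<dots> = (\<Sum>p\<in>Sigma ?O ?A. G (fst p) / real (card (?A (fst p))))"
    by (intro sum.cong refl) (auto simp: available_fun_upd)
  also have "\<dots> = (\<Sum>\<sigma>\<in>?O. \<Sum>c\<in>?A \<sigma>. G \<sigma> / real (card (?A \<sigma>)))"
    using fin by (subst sum.Sigma) (auto simp: finite_available case_prod_unfold)
  also have "\<dots> = (\<Sum>\<sigma>\<in>?O. G \<sigma>)"
  proof (rule sum.cong[OF refl])
    fix \<sigma> assume "\<sigma> \<in> ?O"
    then have "?A \<sigma> \<noteq> {}" using available_self[of \<sigma> E q e] assms(2) by auto
    then show "(\<Sum>c\<in>?A \<sigma>. G \<sigma> / real (card (?A \<sigma>))) = G \<sigma>"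
      by (simp add: finite_available)
  qed
  finally show ?thesis .
qed

lemma mean_resample:
  assumes "finite E" "e \<in> E"
  shows "mean (edge_colorings E q) (\<lambda>\<sigma>. mean (available E q \<sigma> e) (\<lambda>c. G (\<sigma>(e := c))))
    = mean (edge_colorings E q) G"
  unfolding mean_def[of "edge_colorings E q"] sum_resample[OF assms] ..

text \<open>The edges \<open>D\<close> share a vertex and are attached to the edge set \<open>E\<close>; the edges of \<open>E\<close> adjacent
  to them form the set \<open>P\<close>, which holds the parent edge, if there is one.\<close>

locale star_extension =
  fixes E D P :: "'v set set" and q :: nat
  assumes fin: "finite E" "finite D" and disj: "E \<inter> D = {}" and P: "P \<subseteq> E" "card P \<le> 1"
    and clique: "i \<in> D \<Longrightarrow> j \<in> D \<Longrightarrow> i \<noteq> j \<Longrightarrow> adjacent_edges i j"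
    and adj: "i \<in> D \<Longrightarrow> f \<in> E \<Longrightarrow> adjacent_edges i f \<longleftrightarrow> f \<in> P"
begin

abbreviation ext :: "('v set \<Rightarrow> nat) \<Rightarrow> ('v set \<Rightarrow> nat) set" where
  "ext x \<equiv> injections D ({1..q} - x ` P)"

abbreviation comb :: "('v set \<Rightarrow> nat) \<Rightarrow> ('v set \<Rightarrow> nat) \<Rightarrow> 'v set \<Rightarrow> nat" where
  "comb x y \<equiv> override_on x y D"

lemma comb_image: "comb x y ` B = x ` (B - D) \<union> y ` (B \<inter> D)"
  by (auto simp: override_on_def image_iff)

lemma PD: "P \<inter> D = {}" using P disj by auto

lemma neighbours: "g \<in> E \<union> D \<Longrightarrow> {f \<in> E \<union> D. adjacent_edges g f} =
    (if g \<in> D then P \<union> (D - {g}) else if g \<in> P then {f \<in> E. adjacent_edges g f} \<union> D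
     else {f \<in> E. adjacent_edges g f})"
proof -
  assume g: "g \<in> E \<union> D"
  have irr: "\<not> adjacent_edges g g" by (simp add: adjacent_edges_def)
  show ?thesis
  proof (cases "g \<in> D")
    case True
    then have "{f \<in> E. adjacent_edges g f} = P" "{f \<in> D. adjacent_edges g f} = D - {g}"
      using adj[OF True] clique[OF True] irr P(1) by blast+
    then show ?thesis using True by auto
  next
    case False
    then have "{f \<in> D. adjacent_edges g f} = (if g \<in> P then D else {})"
      using adj[of _ g] g adjacent_edges_sym[of g] by auto
    moreover have "{f \<in> E \<union> D. adjacent_edges g f}
        = {f \<in> E. adjacent_edges g f} \<union> {f \<in> D. adjacent_edges g f}" by auto
    ultimately show ?thesis using False by (simp only: if_False Un_empty_right split: if_split) simp
  qed
qed

text \<open>As \<open>D\<close> is a clique that meets \<open>E\<close> only in \<open>P\<close>,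
  properness at \<open>D\<close> amounts to injectivity and avoidance of the color on
  \<open>P\<close>.\<close>

lemma bij_betw_comb:
  "bij_betw (\<lambda>(x, y). comb x y) (Sigma (edge_colorings E q) ext) (edge_colorings (E \<union> D) q)"
proof (rule bij_betw_byWitness[where f' = "\<lambda>\<sigma>. (restrict \<sigma> E, restrict \<sigma> D)"])
  show "\<forall>a\<in>Sigma (edge_colorings E q) ext.
      (\<lambda>\<sigma>. (restrict \<sigma> E, restrict \<sigma> D)) ((\<lambda>(x, y). comb x y) a) = a"
    using disj by (auto simp: edge_colorings_def injections_def PiE_def extensional_def
        override_on_def restrict_def fun_eq_iff)
  show "\<forall>a\<in>edge_colorings (E \<union> D) q.
      (\<lambda>(x, y). comb x y) ((\<lambda>\<sigma>. (restrict \<sigma> E, restrict \<sigma> D)) a) = a"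
    by (auto simp: edge_colorings_def PiE_def extensional_def
        override_on_def restrict_def fun_eq_iff)
  show "(\<lambda>(x, y). comb x y) ` Sigma (edge_colorings E q) ext \<subseteq> edge_colorings (E \<union> D) q"
  proof clarify
    fix x y assume x: "x \<in> edge_colorings E q" and y: "y \<in> ext x"
    have "comb x y \<in> (E \<union> D) \<rightarrow>\<^sub>E {1..q}"
      using x y by (auto simp: edge_colorings_def injections_def PiE_def extensional_def
          override_on_def Pi_def)
    moreover have "comb x y g \<noteq> comb x y f"
      if gf: "g \<in> E \<union> D" "f \<in> E \<union> D" "adjacent_edges g f" for f g
    proof -
      have 1: "y i \<noteq> x h" if "i \<in> D" "h \<in> P" for i h
        using y that by (auto simp: injections_def PiE_def Pi_def)
      have 2: "y i \<noteq> y j" if "i \<in> D" "j \<in> D" "i \<noteq> j" for i j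
        using y that by (auto simp: injections_def inj_on_def)
      have 3: "x i \<noteq> x j" if "i \<in> E" "j \<in> E" "adjacent_edges i j" for i j
        using x that by (auto simp: edge_colorings_def)
      have 4: "g \<noteq> f" using gf by (auto simp: adjacent_edges_def)
      have 5: "f \<in> P" if "g \<in> D" "f \<in> E" using adj that gf by blast
      have 6: "g \<in> P" if "f \<in> D" "g \<in> E" using adj that gf adjacent_edges_sym by blast
      consider "g \<in> D" "f \<in> D" | "g \<in> D" "f \<in> E" "f \<notin> D" | "g \<in> E" "g \<notin> D" "f \<in> D"
        | "g \<in> E" "g \<notin> D" "f \<in> E" "f \<notin> D" using gf by blast
      then show ?thesis
        by cases (use 1 2 3 4 5 6 gf in \<open>auto simp: override_on_def dest: sym\<close>)
    qed
    ultimately show "comb x y \<in> edge_colorings (E \<union> D) q"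
      unfolding edge_colorings_def by blast
  qed
  show "(\<lambda>\<sigma>. (restrict \<sigma> E, restrict \<sigma> D)) ` edge_colorings (E \<union> D) q
      \<subseteq> Sigma (edge_colorings E q) ext"
  proof (rule image_subsetI)
    fix \<sigma> assume s: "\<sigma> \<in> edge_colorings (E \<union> D) q"
    have ne: "\<sigma> g \<noteq> \<sigma> f" if "g \<in> E \<union> D" "f \<in> E \<union> D" "adjacent_edges g f" for f g
      using s that by (auto simp: edge_colorings_def)
    have "restrict \<sigma> E \<in> edge_colorings E q"
      using s by (auto simp: edge_colorings_def PiE_def Pi_def)
    moreover have "restrict \<sigma> D \<in> ext (restrict \<sigma> E)"
    proof -
      have "inj_on \<sigma> D" using clique ne by (meson UnI2 inj_onI)
      moreover have "\<sigma> i \<noteq> \<sigma> h" if "i \<in> D" "h \<in> P" for i h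
        using that adj P ne by (meson UnI1 UnI2 subsetD)
      ultimately show ?thesis
        using s P by (auto simp: injections_def edge_colorings_def PiE_def Pi_def subset_iff)
    qed
    ultimately show "(restrict \<sigma> E, restrict \<sigma> D) \<in> Sigma (edge_colorings E q) ext" by blast
  qed
qed

lemma card_colors_minus_parent:
  assumes "x \<in> edge_colorings E q"
  shows "card ({1..q} - x ` P) = q - card P"
proof -
  have fP: "finite P" using P(1) fin(1) by (rule finite_subset)
  have "inj_on x P"
    using P(2) card_le_Suc0_iff_eq[OF fP] by (auto intro: inj_onI)
  then have "card (x ` P) = card P" by (rule card_image)
  moreover have "x ` P \<subseteq> {1..q}" using assms P by (auto simp: edge_colorings_def)
  ultimately show ?thesis using fP by (simp add: card_Diff_subset)
qed

text \<open>The number of extensions does not depend on \<open>x\<close>, so a uniform coloring of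
  \<open>E \<union> D\<close> restricts to a uniform coloring of \<open>E\<close>.\<close>

lemma card_ext: "x \<in> edge_colorings E q \<Longrightarrow> card (ext x) = (\<Prod>j<card D. q - card P - j)"
  using fin by (simp add: card_injections card_colors_minus_parent)

lemma mean_comb:
  "mean (edge_colorings (E \<union> D) q) f = mean (edge_colorings E q) (\<lambda>x. mean (ext x) (\<lambda>y. f (comb x y)))"
  and vari_comb:
  "vari (edge_colorings (E \<union> D) q) f = mean (edge_colorings E q) (\<lambda>x. vari (ext x) (\<lambda>y. f (comb x y)))
    + vari (edge_colorings E q) (\<lambda>x. mean (ext x) (\<lambda>y. f (comb x y)))"
  using mean_bij_betw[OF bij_betw_comb, of f] vari_bij_betw[OF bij_betw_comb, of f] fin
    mean_Sigma[of "edge_colorings E q" ext, OF _ _ card_ext]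
    vari_Sigma[of "edge_colorings E q" ext, OF _ _ card_ext]
  by (simp_all add: finite_edge_colorings finite_injections)

lemma local_vari_child:
  assumes "i \<in> D"
  shows "local_vari (E \<union> D) q i f = mean (edge_colorings E q) (\<lambda>x. mean (ext x)
    (\<lambda>y. vari ({1..q} - x ` P - y ` (D - {i})) (\<lambda>c. f (comb x (y(i := c))))))"
proof -
  have "P - D = P" "P \<inter> D = {}" using PD by auto
  then have "available (E \<union> D) q (comb x y) i = {1..q} - x ` P - y ` (D - {i})" for x y
    unfolding available_def using assms neighbours[of i]
    by (auto simp: comb_image Un_Diff Int_Un_distrib2)
  moreover have "(comb x y)(i := c) = comb x (y(i := c))" for x y c
    using assms by (auto simp: override_on_def)
  ultimately show ?thesis
    unfolding local_vari_def mean_comb by simp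
qed

lemma mean_vari_ext_le:
  assumes "card D + card P + 2 \<le> q"
  shows "mean (edge_colorings E q) (\<lambda>x. vari (ext x) (\<lambda>y. f (comb x y)))
    \<le> 4 * real (card D) * (\<Sum>i\<in>D. local_vari (E \<union> D) q i f)"
proof -
  have "mean (edge_colorings E q) (\<lambda>x. vari (ext x) (\<lambda>y. f (comb x y)))
    \<le> mean (edge_colorings E q) (\<lambda>x. 4 * real (card D) * (\<Sum>i\<in>D. mean (ext x)
    (\<lambda>y. vari ({1..q} - x ` P - y ` (D - {i})) (\<lambda>c. f (comb x (y(i := c)))))))"
    using fin assms by (intro mean_mono vari_injections_le) (auto simp: card_colors_minus_parent)
  then show ?thesis
    by (simp add: mean_cmult mean_sum local_vari_child)
qed

text \<open>Resampling \<open>g\<close> leaves the color on \<open>P\<close> and hence the law of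
  the star unchanged, so Jensen's inequality applies.\<close>

lemma local_vari_distant_le:
  assumes g: "g \<in> E" "g \<notin> P"
  shows "local_vari E q g (\<lambda>x. mean (ext x) (\<lambda>y. f (comb x y))) \<le> local_vari (E \<union> D) q g f"
proof -
  have gD: "g \<notin> D" using g disj by auto
  have upd: "(x(g := c)) ` P = x ` P" for x :: "'v set \<Rightarrow> nat" and c using g by auto
  have "local_vari E q g (\<lambda>x. mean (ext x) (\<lambda>y. f (comb x y)))
    \<le> mean (edge_colorings E q) (\<lambda>x. mean (ext x)
        (\<lambda>y. vari (available E q x g) (\<lambda>c. f (comb (x(g := c)) y))))"
    unfolding local_vari_def upd by (intro mean_mono vari_mean_le)
  moreover have "available (E \<union> D) q (comb x y) g = available E q x g" for x y
  proof -
    have "{f \<in> E. adjacent_edges g f} - D = {f \<in> E. adjacent_edges g f}"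
      "{f \<in> E. adjacent_edges g f} \<inter> D = {}"
      using disj by auto
    then show ?thesis
      unfolding available_def using g gD neighbours[of g] by (simp add: comb_image)
  qed
  moreover have "(comb x y)(g := c) = comb (x(g := c)) y" for x y c
    using gD by (auto simp: override_on_def)
  ultimately show ?thesis
    unfolding local_vari_def[of "E \<union> D"] mean_comb by simp
qed

text \<open>The star estimate is applied for each coloring \<open>x\<close> with palette
  \<open>{1..q}\<close> and \<open>A\<close> the colors available to \<open>e\<close>.\<close>

lemma local_vari_parent_le:
  assumes Pe: "P = {e}" and card: "card D + 3 \<le> q" and eps: "\<epsilon> > 0"
    and av: "\<And>x. x \<in> edge_colorings E q \<Longrightarrow> 3 \<le> card (available E q x e)"
  shows "local_vari E q e (\<lambda>x. mean (ext x) (\<lambda>y. f (comb x y)))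
    \<le> (1 + \<epsilon>)\<^sup>2 * (real (card D) / real (q - 1)) * (\<Sum>i\<in>D. local_vari (E \<union> D) q i f)
      + ((1 + \<epsilon>) * (1 + 1 / \<epsilon>) * (real (card D) / real (q - 1)) * real (card D) + (1 + 1 / \<epsilon>))
        * local_vari (E \<union> D) q e f"
    (is "_ \<le> ?a * _ + ?b * _")
proof -
  have e: "e \<in> E" "e \<notin> D" using P disj Pe by auto
  define Gi where "Gi i x = mean (ext x)
    (\<lambda>y. vari ({1..q} - x ` P - y ` (D - {i})) (\<lambda>c. f (comb x (y(i := c)))))" for i x
  define Ge where "Ge x = mean (ext x)
    (\<lambda>y. vari (available E q x e - y ` D) (\<lambda>c. f (comb (x(e := c)) y)))" for x
  have "local_vari E q e (\<lambda>x. mean (ext x) (\<lambda>y. f (comb x y)))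
    = mean (edge_colorings E q) (\<lambda>x. vari (available E q x e)
        (\<lambda>c. mean (injections D ({1..q} - {c})) (\<lambda>y. f (comb (x(e := c)) y))))"
    unfolding local_vari_def Pe by simp
  also have "\<dots> \<le> mean (edge_colorings E q) (\<lambda>x. ?a *
      (\<Sum>i\<in>D. mean (available E q x e) (\<lambda>c. mean (injections D ({1..q} - {c}))
          (\<lambda>y. vari ({1..q} - {c} - y ` (D - {i})) (\<lambda>z. f (comb (x(e := c)) (y(i := z)))))))
      + ?b * mean (available E q x e) (\<lambda>c. mean (injections D ({1..q} - {c}))
          (\<lambda>y. vari (available E q x e - y ` D) (\<lambda>z. f (comb (x(e := z)) y)))))"
  proof (rule mean_mono)
    fix x assume x: "x \<in> edge_colorings E q"
    have "available E q x e \<subseteq> {1..q}" by (auto simp: available_def)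
    from vari_mean_injections_dep_le[OF fin(2) _ this av[OF x] _ eps, of "\<lambda>c y. f (comb (x(e := c)) y)"]
    show "vari (available E q x e)
        (\<lambda>c. mean (injections D ({1..q} - {c})) (\<lambda>y. f (comb (x(e := c)) y))) \<le> ?a *
      (\<Sum>i\<in>D. mean (available E q x e) (\<lambda>c. mean (injections D ({1..q} - {c}))
          (\<lambda>y. vari ({1..q} - {c} - y ` (D - {i})) (\<lambda>z. f (comb (x(e := c)) (y(i := z)))))))
      + ?b * mean (available E q x e) (\<lambda>c. mean (injections D ({1..q} - {c}))
          (\<lambda>y. vari (available E q x e - y ` D) (\<lambda>z. f (comb (x(e := z)) y))))"
      using card by simp
  qed
  also have "\<dots> = mean (edge_colorings E q) (\<lambda>x. ?a *
      (\<Sum>i\<in>D. mean (available E q x e) (\<lambda>c. Gi i (x(e := c))))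
      + ?b * mean (available E q x e) (\<lambda>c. Ge (x(e := c))))"
    unfolding Gi_def Ge_def Pe by (simp add: available_fun_upd)
  \<comment> \<open>Averaged over \<open>x\<close>, the resampling of \<open>e\<close> inside the
    bound disappears by stationarity.\<close>
  also have "\<dots> = ?a * (\<Sum>i\<in>D. mean (edge_colorings E q) (Gi i)) + ?b * mean (edge_colorings E q) Ge"
    by (simp only: mean_add mean_cmult mean_sum mean_resample[OF fin(1) e(1)])
  also have "mean (edge_colorings E q) Ge = local_vari (E \<union> D) q e f"
  proof -
    have "available (E \<union> D) q (comb x y) e = available E q x e - y ` D" for x y
    proof -
      have "{f \<in> E. adjacent_edges e f} - D = {f \<in> E. adjacent_edges e f}"
        "{f \<in> E. adjacent_edges e f} \<inter> D = {}"
        using disj by auto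
      then show ?thesis
        unfolding available_def using e neighbours[of e] Pe
        by (auto simp: comb_image Un_Diff Int_Un_distrib2)
    qed
    moreover have "(comb x y)(e := c) = comb (x(e := c)) y" for x y c
      using e by (auto simp: override_on_def)
    ultimately show ?thesis
      unfolding local_vari_def[of "E \<union> D"] mean_comb Ge_def by simp
  qed
  also have "(\<Sum>i\<in>D. mean (edge_colorings E q) (Gi i)) = (\<Sum>i\<in>D. local_vari (E \<union> D) q i f)"
    by (intro sum.cong refl) (simp add: local_vari_child Gi_def[abs_def])
  finally show ?thesis .
qed

end

section \<open>Tensorization of variance on forests\<close>

text \<open>An edge from the first vertex to a later vertex of the path than the second closes an
  initial segment to a cycle.\<close>

lemma path_back_edge:
  assumes acyclic: "\<nexists>xs. graph_cycle E xs"
    and path: "distinct xs" "successively (\<lambda>a b. {a, b} \<in> E) xs"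
    and z: "z \<in> set xs" "{z, hd xs} \<in> E" "z \<noteq> hd xs"
  shows "z = xs ! 1"
proof (rule ccontr)
  assume z1: "z \<noteq> xs ! 1"
  obtain j where j: "j < length xs" "xs ! j = z" using z(1) by (auto simp: in_set_conv_nth)
  have "j \<noteq> 0" using j z(3) by (metis hd_conv_nth list.size(3) not_less_zero)
  moreover have "j \<noteq> 1" using j z1 by auto
  ultimately have j2: "2 \<le> j" by simp
  have "graph_cycle E (take (Suc j) xs)"
    unfolding graph_cycle_def
  proof (intro conjI allI impI)
    show "3 \<le> length (take (Suc j) xs)" using j j2 by simp
    show "distinct (take (Suc j) xs)" using path(1) by (rule distinct_take)
    have "last (take (Suc j) xs) = z" using j by (simp add: take_Suc_conv_app_nth)
    moreover have "hd (take (Suc j) xs) = hd xs" by (rule hd_take) simp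
    ultimately show "{last (take (Suc j) xs), hd (take (Suc j) xs)} \<in> E" using z(2) by simp
    fix i assume "Suc i < length (take (Suc j) xs)"
    then show "{take (Suc j) xs ! i, take (Suc j) xs ! Suc i} \<in> E"
      using path(2) by (simp add: successively_conv_nth)
  qed
  then show False using acyclic by blast
qed

text \<open>The second vertex of a longest path has at most one neighbour that is not a leaf.\<close>

lemma forest_has_leaf_star:
  assumes fin: "finite E" and two: "\<And>e. e \<in> E \<Longrightarrow> card e = 2"
    and acyclic: "\<nexists>xs. graph_cycle E xs" and ne: "E \<noteq> {}"
  obtains e v where "e \<in> E" "v \<in> e"
    and "\<forall>f\<in>E. \<forall>g\<in>E. v \<in> f \<and> f \<noteq> e \<and> g \<noteq> f \<and> g \<inter> f \<noteq> {} \<longrightarrow> v \<in> g"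
    and "{f \<in> E. v \<in> f \<and> f \<noteq> e} = {} \<longrightarrow> (\<forall>g\<in>E. g \<noteq> e \<longrightarrow> g \<inter> e = {})"
proof -
  define path where "path xs \<longleftrightarrow> distinct xs \<and> successively (\<lambda>a b. {a, b} \<in> E) xs \<and> 2 \<le> length xs"
    for xs
  have other: "\<exists>u. f = {w, u} \<and> u \<noteq> w" if "f \<in> E" "w \<in> f" for f w
    using two[OF that(1)] that(2) by (auto simp: card_2_iff)
  have finV: "finite (\<Union> E)"
    using fin two by (metis card.infinite finite_Union zero_neq_numeral)
  have "set xs \<subseteq> \<Union> E" if "path xs" for xs
  proof
    fix x assume "x \<in> set xs"
    then obtain i where i: "i < length xs" "xs ! i = x" by (auto simp: in_set_conv_nth)
    have st: "{xs ! k, xs ! Suc k} \<in> E" if "Suc k < length xs" for k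
      using that \<open>path xs\<close> by (auto simp: path_def successively_conv_nth)
    show "x \<in> \<Union> E"
    proof (cases i)
      case 0
      then show ?thesis using st[of 0] i \<open>path xs\<close> by (auto simp: path_def)
    next
      case (Suc k)
      then show ?thesis using st[of k] i by auto
    qed
  qed
  then have bound: "length xs < Suc (card (\<Union> E))" if "path xs" for xs
    using that card_mono[OF finV, of "set xs"] by (auto simp: path_def distinct_card)
  obtain e0 where e0: "e0 \<in> E" using ne by auto
  then obtain u w where uw: "e0 = {u, w}" "u \<noteq> w" using two by (meson card_2_iff)
  then have "path [u, w]" using e0 by (simp add: path_def)
  from ex_has_greatest_nat[of path, OF this, of length "Suc (card (\<Union> E))"] bound
  obtain xs where xs: "path xs" and max: "\<And>ys. path ys \<Longrightarrow> length ys \<le> length xs"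
    by (metis less_imp_le)
  obtain a b ys where ab: "xs = a # b # ys"
    using xs by (auto simp: path_def neq_Nil_conv Suc_le_length_iff numeral_2_eq_2)
  have ab': "{a, b} \<in> E" "a \<noteq> b" using xs by (auto simp: path_def ab)
  show thesis
  proof (cases ys)
    case Nil
    \<comment> \<open>The longest path is a single edge, so no two edges meet and the chosen edge
      has an empty star.\<close>
    have len: "length zs \<le> 2" if "path zs" for zs using max[OF that] by (simp add: ab Nil)
    have iso: "g = {a, b}" if g: "g \<in> E" "g \<inter> {a, b} \<noteq> {}" for g
    proof (rule ccontr)
      assume neq: "g \<noteq> {a, b}"
      show False
      proof (cases "a \<in> g")
        case True
        then obtain c where c: "g = {a, c}" "c \<noteq> a" using other g by blast
        then have "path [c, a, b]" using g ab' neq by (auto simp: path_def insert_commute)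
        from len[OF this] show False by simp
      next
        case False
        then obtain c where c: "g = {b, c}" "c \<noteq> b" using other g by blast
        then have "path [c, b, a]" using g ab' neq by (auto simp: path_def insert_commute)
        from len[OF this] show False by simp
      qed
    qed
    show thesis
    proof (rule that[of "{a, b}" b])
      show "{f \<in> E. b \<in> f \<and> f \<noteq> {a, b}} = {} \<longrightarrow> (\<forall>g\<in>E. g \<noteq> {a, b} \<longrightarrow> g \<inter> {a, b} = {})"
        using iso by blast
      show "\<forall>f\<in>E. \<forall>g\<in>E. b \<in> f \<and> f \<noteq> {a, b} \<and> g \<noteq> f \<and> g \<inter> f \<noteq> {} \<longrightarrow> b \<in> g"
        using iso by blast
    qed (use ab' in auto)
  next
    case (Cons c zs)
    have bc: "{b, c} \<in> E" "a \<noteq> c" using xs by (auto simp: path_def ab Cons)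
    have tail: "distinct (b # c # zs)" "successively (\<lambda>a b. {a, b} \<in> E) (b # c # zs)"
      using xs by (auto simp: path_def ab Cons)
    show thesis
    proof (rule that[of "{b, c}" b]; (intro ballI impI; (elim conjE)?)?)
      fix f g assume "f \<in> E" "g \<in> E" "b \<in> f" "f \<noteq> {b, c}" "g \<noteq> f" "g \<inter> f \<noteq> {}"
      note f = this(1,3,4) and g = this(2,5,6)
      show "b \<in> g"
      proof (rule ccontr)
        assume bg: "b \<notin> g"
        obtain y where y: "f = {b, y}" "y \<noteq> b" using other f by blast
        then have "y \<in> g" using g bg by auto
        then obtain z where z: "g = {y, z}" "z \<noteq> y" using other g by blast
        have yc: "y \<noteq> c" using f y by auto
        \<comment> \<open>Replacing \<open>a\<close> by \<open>y\<close> gives another longest path,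
          as \<open>y\<close> on the tail would close a cycle. A neighbor \<open>z\<close> of
          \<open>y\<close> then either lengthens this path or equals \<open>b\<close>.\<close>
        have "y \<notin> set (b # c # zs)"
          using path_back_edge[OF acyclic tail, of y] y yc f by (auto simp: insert_commute)
        then have p: "distinct (y # b # c # zs)" "successively (\<lambda>a b. {a, b} \<in> E) (y # b # c # zs)"
          using tail y f by (auto simp: insert_commute)
        have "z \<in> set (y # b # c # zs)"
        proof (rule ccontr)
          assume "z \<notin> set (y # b # c # zs)"
          then have "path (z # y # b # c # zs)"
            using p z g by (simp add: path_def insert_commute)
          from max[OF this] show False by (simp add: ab Cons)
        qed
        then have "z = b"
          using path_back_edge[OF acyclic p, of z] z g by (simp add: insert_commute)
        then show False using bg z by auto
      qed
    next
      fix g assume "{f \<in> E. b \<in> f \<and> f \<noteq> {b, c}} = {}"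
      moreover have "{a, b} \<in> {f \<in> E. b \<in> f \<and> f \<noteq> {b, c}}"
        using ab' bc by (auto simp: doubleton_eq_iff)
      ultimately show "g \<inter> {b, c} = {}" by blast
    qed (use bc in auto)
  qed
qed

text \<open>The number of non-leaf ends. Reading the inflation count off the current forest frees
  the induction hypothesis from the history of attachments.\<close>

definition inner_ends :: "'v set set \<Rightarrow> 'v set \<Rightarrow> nat" where
  "inner_ends E e = card {x \<in> e. \<exists>g\<in>E. g \<noteq> e \<and> x \<in> g}"

lemma inner_ends_mono: "finite e \<Longrightarrow> E \<subseteq> F \<Longrightarrow> inner_ends E e \<le> inner_ends F e"
  unfolding inner_ends_def by (rule card_mono) auto

text \<open>The weight of an edge grows by the factor \<open>K'\<close> whenever a star is attached at one of its ends,
  which happens at most twice; a newly attached edge starts with weight at most \<open>W\<close>.\<close>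

definition edge_weight :: "real \<Rightarrow> real \<Rightarrow> real \<Rightarrow> nat \<Rightarrow> real" where
  "edge_weight K K' W n = (if n = 0 then K else if n = 1 then W else K' * W)"

text \<open>Total variance for a leaf star \<open>D\<close> with parent \<open>e\<close>: the star
  itself costs at most \<open>K\<close> per child, and the induction hypothesis handles the
  conditional mean. Its distant terms do not grow, while its parent term becomes
  \<open>\<delta>\<close> times the child terms plus \<open>K'\<close> times the new parent
  term.\<close>

lemma forest_vari_le:
  fixes E :: "'v set set"
  assumes fin: "finite E" and two: "\<And>e. e \<in> E \<Longrightarrow> card e = 2"
    and acyclic: "\<nexists>xs. graph_cycle E xs"
    and deg: "\<And>v. card {e \<in> E. v \<in> e} \<le> \<Delta>" and q: "\<Delta> + 2 \<le> q"
    and eps: "\<epsilon> > 0" and K: "K = 4 * real q" and \<delta>: "\<delta> < 1"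
    and \<delta>_bound: "(1 + \<epsilon>)\<^sup>2 * (real (q - 3) / real (q - 1)) \<le> \<delta>"
    and K': "K' = (1 + \<epsilon>) * (1 + 1 / \<epsilon>) * real q + (1 + 1 / \<epsilon>)"
    and W: "W = K' * K / (1 - \<delta>)"
  shows "vari (edge_colorings E q) f
    \<le> (\<Sum>e\<in>E. edge_weight K K' W (inner_ends E e) * local_vari E q e f)"
  using fin two acyclic deg
proof (induction "card E" arbitrary: E f rule: less_induct)
  case less
  note E = less.prems
  have q2: "2 \<le> q" using q by simp
  have \<delta>0: "0 \<le> \<delta>" using \<delta>_bound eps by (smt (verit) divide_nonneg_nonneg mult_nonneg_nonneg of_nat_0_le_iff zero_le_power2)
  have K0: "0 < K" using K q2 by simp
  have K'1: "1 \<le> K'" using eps K' by (simp add: add_increasing)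
  have "K \<le> K' * K" using K0 K'1 by simp
  \<comment> \<open>\<open>K / (1 - \<delta>)\<close> would already solve the fixed point equation;
    the additional \<open>K'\<close> yields \<open>K' * K \<le> W\<close>, for an isolated edge that
    becomes a parent.\<close>
  moreover have "W * (1 - \<delta>) = K' * K" using \<delta> by (simp add: W)
  ultimately have KW: "K + \<delta> * W \<le> W" by (simp add: algebra_simps)
  have "K' * K * 1 \<le> K' * K / (1 - \<delta>)"
    using K0 K'1 \<delta> \<delta>0 by (simp add: le_divide_eq mult_left_le)
  then have K'W: "K' * K \<le> W" by (simp add: W)
  have W0: "K \<le> W" using \<open>K \<le> K' * K\<close> K'W by simp
  have WW: "W \<le> K' * W" using W0 K0 K'1 by simp
  let ?w = "edge_weight K K' W"
  have w_mono: "?w m \<le> ?w n" if "m \<le> n" for m n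
    using that W0 WW by (auto simp: edge_weight_def)
  have w_nonneg: "0 \<le> ?w n" for n
    using W0 WW K0 by (auto simp: edge_weight_def)
  have w_Suc: "K' * ?w m \<le> ?w n" if "m \<le> 1" "Suc m \<le> n" for m n
    using that K'W WW K0 by (auto simp: edge_weight_def)
  have finE: "finite e" if "e \<in> E" for e using E(2)[OF that] card.infinite by fastforce
  have card_E: "card E' < card E" if "E' \<subset> E" for E' using psubset_card_mono[OF E(1) that] .
  have acyclic': "\<nexists>xs. graph_cycle E' xs" if "E' \<subseteq> E" for E'
    using E(3) that unfolding graph_cycle_def by blast
  have deg': "card {e \<in> E'. v \<in> e} \<le> \<Delta>" if "E' \<subseteq> E" for E' v
    using E(4)[of v] card_mono[of "{e \<in> E. v \<in> e}" "{e \<in> E'. v \<in> e}"] E(1) that by fastforce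
  have IH: "vari (edge_colorings E' q) h
      \<le> (\<Sum>e\<in>E'. ?w (inner_ends E' e) * local_vari E' q e h)" if "E' \<subset> E" for E' h
  proof (rule less.hyps)
    show "card E' < card E" by (rule card_E[OF that])
    show "finite E'" using that E(1) finite_subset by blast
    show "card e = 2" if "e \<in> E'" for e using that \<open>E' \<subset> E\<close> E(2) by blast
    show "\<nexists>xs. graph_cycle E' xs" "card {e \<in> E'. v \<in> e} \<le> \<Delta>" for v
      using acyclic' deg' that by blast+
  qed
  show ?case
  proof (cases "E = {}")
    case True
    have "edge_colorings E q = {\<lambda>_. undefined}" unfolding True by (auto simp: edge_colorings_def)
    then show ?thesis by (simp add: vari_def mean_def True)
  next
    case False
    obtain e v where e: "e \<in> E" "v \<in> e"
      and star: "\<forall>f\<in>E. \<forall>g\<in>E. v \<in> f \<and> f \<noteq> e \<and> g \<noteq> f \<and> g \<inter> f \<noteq> {} \<longrightarrow> v \<in> g"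
      and iso: "{f \<in> E. v \<in> f \<and> f \<noteq> e} = {} \<longrightarrow> (\<forall>g\<in>E. g \<noteq> e \<longrightarrow> g \<inter> e = {})"
      by (rule forest_has_leaf_star[OF E(1,2,3) False])
    define D where "D = {f \<in> E. v \<in> f \<and> f \<noteq> e}"
    have "{f \<in> E. v \<in> f} = insert e D" using e by (auto simp: D_def)
    moreover have "finite D" "e \<notin> D" using E(1) by (auto simp: D_def)
    ultimately have cD: "card D + 1 \<le> \<Delta>" using E(4)[of v] by simp
    show ?thesis
    proof (cases "D = {}")
      case True
      let ?E = "E - {e}"
      have Ee: "?E \<union> {e} = E" using e by auto
      \<comment> \<open>An isolated edge is a one-edge star without parent, at cost
        \<open>4 \<le> K\<close>.\<close>
      interpret star_extension ?E "{e}" "{}" q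
        using E(1) iso True by unfold_locales (auto simp: adjacent_edges_def D_def)
      have "vari (edge_colorings E q) f
        \<le> 4 * local_vari E q e f + (\<Sum>g\<in>?E. ?w (inner_ends ?E g) * local_vari ?E q g (\<lambda>x. mean (ext x) (\<lambda>y. f (comb x y))))"
      proof -
        have "?E \<subset> E" using e by auto
        note IH = IH[OF this, of "\<lambda>x. mean (ext x) (\<lambda>y. f (comb x y))"]
        have "mean (edge_colorings ?E q) (\<lambda>x. vari (ext x) (\<lambda>y. f (comb x y))) \<le> 4 * local_vari E q e f"
          using mean_vari_ext_le[of f] cD q unfolding Ee by simp
        then show ?thesis unfolding vari_comb[of f, unfolded Ee] using IH by (rule add_mono)
      qed
      also have "\<dots> \<le> ?w (inner_ends E e) * local_vari E q e f + (\<Sum>g\<in>?E. ?w (inner_ends E g) * local_vari E q g f)"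
      proof (intro add_mono sum_mono mult_mono w_mono inner_ends_mono mult_right_mono local_vari_nonneg w_nonneg)
        have "4 \<le> K" using K q2 by simp
        also have "K \<le> ?w (inner_ends E e)" using w_mono[of 0] by (simp add: edge_weight_def)
        finally show "4 \<le> ?w (inner_ends E e)" .
        fix g assume "g \<in> ?E"
        then show "local_vari ?E q g (\<lambda>x. mean (ext x) (\<lambda>y. f (comb x y))) \<le> local_vari E q g f"
          using local_vari_distant_le[of g f] unfolding Ee by simp
      qed (use finE in auto)
      also have "\<dots> = (\<Sum>g\<in>E. ?w (inner_ends E g) * local_vari E q g f)"
        using E(1) e by (simp add: sum.remove)
      finally show ?thesis .
    next
      case False
      define E' where "E' = E - D"
      have ED: "E' \<union> D = E" by (auto simp: E'_def D_def)
      have sub: "E' \<subset> E" using False by (auto simp: E'_def D_def)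
      have finE': "finite E'" using E(1) by (simp add: E'_def)
      have eE': "e \<in> E'" using e by (simp add: E'_def D_def)
      interpret star_extension E' D "{e}" q
      proof
        show "finite E'" "finite D" using E(1) by (auto simp: E'_def D_def)
        show "E' \<inter> D = {}" "{e} \<subseteq> E'" "card {e} \<le> 1" using eE' by (auto simp: E'_def)
        fix i j assume "i \<in> D" "j \<in> D" "i \<noteq> j"
        then show "adjacent_edges i j" by (auto simp: D_def adjacent_edges_def)
      next
        fix i g assume i: "i \<in> D" and g: "g \<in> E'"
        show "adjacent_edges i g \<longleftrightarrow> g \<in> {e}"
        proof
          assume "adjacent_edges i g"
          then have "v \<in> g" using star i g by (auto simp: D_def E'_def adjacent_edges_def)
          then show "g \<in> {e}" using g by (auto simp: D_def E'_def)
        next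
          assume "g \<in> {e}"
          then show "adjacent_edges i g" using i e by (auto simp: D_def adjacent_edges_def)
        qed
      qed
      let ?h = "\<lambda>x. mean (ext x) (\<lambda>y. f (comb x y))"
      let ?L = "\<lambda>g. local_vari E q g f"
      define w where "w = ?w (inner_ends E' e)"
      have w0: "0 \<le> w" unfolding w_def by (rule w_nonneg)
      obtain u where u: "e = {v, u}" "u \<noteq> v" using E(2)[OF e(1)] e(2) by (auto simp: card_2_iff)
      have only_e: "g = e" if "g \<in> E'" "v \<in> g" for g using that by (auto simp: E'_def D_def)
      \<comment> \<open>All other edges at \<open>v\<close> belong to \<open>D\<close>, so
        \<open>v\<close> is a free end of \<open>e\<close> in \<open>E'\<close> and an inner end in
        \<open>E\<close>.\<close>
      have ends: "inner_ends E' e \<le> 1" "Suc (inner_ends E' e) \<le> inner_ends E e"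
      proof -
        let ?X = "{x \<in> e. \<exists>g\<in>E'. g \<noteq> e \<and> x \<in> g}" and ?Y = "{x \<in> e. \<exists>g\<in>E. g \<noteq> e \<and> x \<in> g}"
        have vX: "v \<notin> ?X" using only_e by blast
        then have "?X \<subseteq> {u}" using u by auto
        then show "inner_ends E' e \<le> 1" unfolding inner_ends_def using card_mono[of "{u}" ?X] by simp
        have "v \<in> ?Y" using False e by (auto simp: D_def)
        then have "insert v ?X \<subseteq> ?Y" using sub by auto
        then have "card (insert v ?X) \<le> card ?Y" using finE[OF e(1)] by (intro card_mono) auto
        then show "Suc (inner_ends E' e) \<le> inner_ends E e"
          unfolding inner_ends_def using vX finE[OF e(1)] by simp
      qed
      have wW: "w \<le> W" unfolding w_def using ends W0 by (auto simp: edge_weight_def)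
      \<comment> \<open>In \<open>E'\<close> the neighbors of \<open>e\<close> all sit at
        \<open>u\<close>. There are at most \<open>\<Delta> - 1\<close> of them, leaving
        \<open>q - \<Delta> + 1 \<ge> 3\<close> colors.\<close>
      have av: "3 \<le> card (available E' q x e)" for x
      proof -
        have "{g \<in> E'. adjacent_edges e g} \<subseteq> {g \<in> E. u \<in> g} - {e}"
          using only_e u sub by (auto simp: adjacent_edges_def)
        then have "card {g \<in> E'. adjacent_edges e g} \<le> card ({g \<in> E. u \<in> g} - {e})"
          using E(1) by (intro card_mono) auto
        also have "\<dots> = card {g \<in> E. u \<in> g} - 1"
          using e u by (intro card_Diff_singleton) auto
        finally have "card {g \<in> E'. adjacent_edges e g} + 1 \<le> \<Delta>" using E(4)[of u] cD by linarith
        moreover have "card (x ` {g \<in> E'. adjacent_edges e g}) \<le> card {g \<in> E'. adjacent_edges e g}"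
          using finE' by (intro card_image_le) auto
        moreover have "q - card (x ` {g \<in> E'. adjacent_edges e g}) \<le> card (available E' q x e)"
          unfolding available_def using diff_card_le_card_Diff[of "x ` {g \<in> E'. adjacent_edges e g}" "{1..q}"]
            finE' by simp
        ultimately show ?thesis using q by linarith
      qed
      have dq: "real (card D) / real (q - 1) \<le> real (q - 3) / real (q - 1)"
        using cD q by (intro divide_right_mono) auto
      have "local_vari E' q e ?h \<le> (1 + \<epsilon>)\<^sup>2 * (real (card D) / real (q - 1)) * (\<Sum>i\<in>D. ?L i)
        + ((1 + \<epsilon>) * (1 + 1 / \<epsilon>) * (real (card D) / real (q - 1)) * real (card D) + (1 + 1 / \<epsilon>)) * ?L e"
        using local_vari_parent_le[OF refl _ eps av, where f = f] cD q by (simp add: ED)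
      also have "\<dots> \<le> \<delta> * (\<Sum>i\<in>D. ?L i) + K' * ?L e"
      proof (intro add_mono mult_right_mono local_vari_nonneg sum_nonneg)
        have "(1 + \<epsilon>)\<^sup>2 * (real (card D) / real (q - 1)) \<le> (1 + \<epsilon>)\<^sup>2 * (real (q - 3) / real (q - 1))"
          by (intro mult_left_mono dq) simp
        then show "(1 + \<epsilon>)\<^sup>2 * (real (card D) / real (q - 1)) \<le> \<delta>" using \<delta>_bound by simp
        have "real (card D) / real (q - 1) * real (card D) \<le> 1 * real q"
          using cD q by (intro mult_mono) auto
        then have "(1 + \<epsilon>) * (1 + 1 / \<epsilon>) * (real (card D) / real (q - 1) * real (card D))
            \<le> (1 + \<epsilon>) * (1 + 1 / \<epsilon>) * real q"
          using eps by (intro mult_left_mono) auto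
        then show "(1 + \<epsilon>) * (1 + 1 / \<epsilon>) * (real (card D) / real (q - 1)) * real (card D) + (1 + 1 / \<epsilon>) \<le> K'"
          unfolding K' by (simp only: mult.assoc add_le_cancel_right)
      qed
      finally have "w * local_vari E' q e ?h \<le> w * (\<delta> * (\<Sum>i\<in>D. ?L i) + K' * ?L e)"
        by (rule mult_left_mono[OF _ w0])
      also have "\<dots> = w * \<delta> * (\<Sum>i\<in>D. ?L i) + K' * w * ?L e"
        by (simp add: algebra_simps)
      also have "K' * w * ?L e \<le> ?w (inner_ends E e) * ?L e"
        using w_Suc[OF ends] by (intro mult_right_mono local_vari_nonneg) (simp add: w_def)
      finally have parent: "w * local_vari E' q e ?h
        \<le> w * \<delta> * (\<Sum>i\<in>D. ?L i) + ?w (inner_ends E e) * ?L e" by simp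
      have "vari (edge_colorings E q) f \<le> 4 * real (card D) * (\<Sum>i\<in>D. ?L i)
          + (\<Sum>g\<in>E'. ?w (inner_ends E' g) * local_vari E' q g ?h)"
        using vari_comb[of f] mean_vari_ext_le[of f] IH[OF sub, of ?h] cD q by (simp add: ED)
      also have "(\<Sum>g\<in>E'. ?w (inner_ends E' g) * local_vari E' q g ?h)
          = w * local_vari E' q e ?h + (\<Sum>g\<in>E' - {e}. ?w (inner_ends E' g) * local_vari E' q g ?h)"
        unfolding w_def using finE' eE' by (rule sum.remove)
      also have "(\<Sum>g\<in>E' - {e}. ?w (inner_ends E' g) * local_vari E' q g ?h)
          \<le> (\<Sum>g\<in>E' - {e}. ?w (inner_ends E g) * ?L g)"
      proof (intro sum_mono mult_mono w_mono inner_ends_mono local_vari_nonneg w_nonneg)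
        fix g assume g: "g \<in> E' - {e}"
        then show "local_vari E' q g ?h \<le> ?L g" using local_vari_distant_le[of g f] by (simp add: ED)
        show "finite g" "E' \<subseteq> E" using g sub finE by auto
      qed
      \<comment> \<open>Each child is charged \<open>K\<close> for the star and at most
        \<open>\<delta> * W\<close> through the parent, whose weight in \<open>E'\<close> is at most
        \<open>W\<close>.\<close>
      also have "4 * real (card D) * (\<Sum>i\<in>D. ?L i) + (w * local_vari E' q e ?h + (\<Sum>g\<in>E' - {e}. ?w (inner_ends E g) * ?L g))
        \<le> (K + \<delta> * W) * (\<Sum>i\<in>D. ?L i) + (?w (inner_ends E e) * ?L e + (\<Sum>g\<in>E' - {e}. ?w (inner_ends E g) * ?L g))"
      proof -
        have s0: "0 \<le> (\<Sum>i\<in>D. ?L i)" by (intro sum_nonneg local_vari_nonneg)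
        have "4 * real (card D) * (\<Sum>i\<in>D. ?L i) \<le> K * (\<Sum>i\<in>D. ?L i)"
          using cD q by (intro mult_right_mono s0) (simp add: K)
        moreover have "w * \<delta> * (\<Sum>i\<in>D. ?L i) \<le> \<delta> * W * (\<Sum>i\<in>D. ?L i)"
          using mult_right_mono[OF wW \<delta>0] by (intro mult_right_mono s0) (simp add: mult.commute)
        ultimately show ?thesis using parent by (simp add: distrib_right)
      qed
      also have "(K + \<delta> * W) * (\<Sum>i\<in>D. ?L i) \<le> (\<Sum>i\<in>D. ?w (inner_ends E i) * ?L i)"
        unfolding sum_distrib_left
      proof (intro sum_mono mult_right_mono local_vari_nonneg)
        fix i assume i: "i \<in> D"
        \<comment> \<open>A child shares \<open>v\<close> with \<open>e\<close>, so it is never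
          isolated and its weight is at least \<open>W\<close>.\<close>
        have "v \<in> {x \<in> i. \<exists>g\<in>E. g \<noteq> i \<and> x \<in> g}" using i e by (auto simp: D_def)
        moreover have "finite {x \<in> i. \<exists>g\<in>E. g \<noteq> i \<and> x \<in> g}" using i finE by (simp add: D_def)
        ultimately have "0 < inner_ends E i"
          unfolding inner_ends_def by (subst card_gt_0_iff) blast
        then have "1 \<le> inner_ends E i" by simp
        then have "?w 1 \<le> ?w (inner_ends E i)" by (rule w_mono)
        then show "K + \<delta> * W \<le> ?w (inner_ends E i)" using KW by (simp add: edge_weight_def)
      qed
      also have "?w (inner_ends E e) * ?L e + (\<Sum>g\<in>E' - {e}. ?w (inner_ends E g) * ?L g)
          = (\<Sum>g\<in>E'. ?w (inner_ends E g) * ?L g)"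
        using finE' eE' by (rule sum.remove[symmetric])
      also have "(\<Sum>i\<in>D. ?w (inner_ends E i) * ?L i) + \<dots> = (\<Sum>g\<in>E. ?w (inner_ends E g) * ?L g)"
        using sum.union_disjoint[of D E' "\<lambda>g. ?w (inner_ends E g) * ?L g"] fin disj
        by (metis ED Int_commute Un_commute)
      finally show ?thesis by simp
    qed
  qed
qed

section \<open>Spectrum of a symmetric chain\<close>

text \<open>For an eigenvector \<open>v\<close> the Hermitian form \<open>T\<close> equals its own
  conjugate, and it is \<open>a\<close> times the positive number \<open>s\<close>.\<close>

lemma symmetric_eigenvalue_real:
  fixes A :: "real mat"
  assumes A: "A \<in> carrier_mat n n" and sym: "\<And>i j. i < n \<Longrightarrow> j < n \<Longrightarrow> A $$ (i, j) = A $$ (j, i)"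
    and ev: "eigenvalue (map_mat complex_of_real A) a"
  shows "a \<in> \<real>"
proof -
  let ?A = "map_mat complex_of_real A"
  obtain v where v: "v \<in> carrier_vec n" "v \<noteq> 0\<^sub>v n" "?A *\<^sub>v v = a \<cdot>\<^sub>v v"
    using ev A unfolding eigenvalue_def eigenvector_def by auto
  have row: "(\<Sum>j<n. of_real (A $$ (i, j)) * v $ j) = a * v $ i" if "i < n" for i
  proof -
    have "(?A *\<^sub>v v) $ i = (a \<cdot>\<^sub>v v) $ i" using v by simp
    then show ?thesis
      using that A v(1) by (simp add: scalar_prod_def atLeast0LessThan)
  qed
  define s where "s = (\<Sum>i<n. cnj (v $ i) * v $ i)"
  define T where "T = (\<Sum>i<n. \<Sum>j<n. cnj (v $ i) * (of_real (A $$ (i, j)) * v $ j))"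
  have T: "T = a * s"
    unfolding T_def s_def by (simp add: sum_distrib_left[symmetric] row mult.left_commute)
  have "cnj T = (\<Sum>i<n. \<Sum>j<n. cnj (v $ j) * (of_real (A $$ (i, j)) * v $ i))"
    unfolding T_def by (simp add: mult_ac)
  also have "\<dots> = (\<Sum>j<n. \<Sum>i<n. cnj (v $ j) * (of_real (A $$ (i, j)) * v $ i))"
    by (rule sum.swap)
  also have "\<dots> = T"
    unfolding T_def using sym by (intro sum.cong refl) auto
  finally have "cnj a * cnj s = a * s" unfolding T by simp
  moreover have "cnj s = s" unfolding s_def by (simp add: mult.commute)
  moreover have "s \<noteq> 0"
  proof -
    obtain k where k: "k < n" "v $ k \<noteq> 0" using v by (metis carrier_vecD eq_vecI index_zero_vec)
    have "s = of_real (\<Sum>i<n. (cmod (v $ i))\<^sup>2)"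
      unfolding s_def of_real_sum by (intro sum.cong refl) (metis complex_norm_square mult.commute)
    moreover have "(\<Sum>i<n. (cmod (v $ i))\<^sup>2) > 0"
      using k by (intro sum_pos2[where i = k]) auto
    ultimately show ?thesis by (metis of_real_eq_0_iff less_irrefl)
  qed
  ultimately have "cnj a = a" by simp
  then show ?thesis by (simp add: Reals_cnj_iff)
qed

text \<open>\<open>proots\<close> of a real polynomial collects only real roots. Factoring over the
  complex numbers, where all roots turn out to be real, shows that none of the \<open>n\<close>
  eigenvalues is missed.\<close>

lemma symmetric_char_poly_splits:
  fixes A :: "real mat"
  assumes A: "A \<in> carrier_mat n n" and sym: "\<And>i j. i < n \<Longrightarrow> j < n \<Longrightarrow> A $$ (i, j) = A $$ (j, i)"
  shows "\<exists>es. char_poly A = (\<Prod>e\<leftarrow>es. [:- e, 1:]) \<and> length es = n"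
proof -
  let ?A = "map_mat complex_of_real A"
  have cA: "?A \<in> carrier_mat n n" using A by simp
  obtain as where as: "char_poly ?A = (\<Prod>a\<leftarrow>as. [:- a, 1:])" "length as = n"
    using char_poly_factorized[OF cA] by auto
  have real: "of_real (Re a) = a" if "a \<in> set as" for a
  proof -
    have "poly (char_poly ?A) a = 0"
      unfolding as(1) poly_prod_list using that by (auto simp: prod_list_zero_iff image_iff intro!: bexI[of _ a])
    then have "eigenvalue ?A a" using eigenvalue_root_char_poly[OF cA] by simp
    from symmetric_eigenvalue_real[OF A sym this] show ?thesis by (rule of_real_Re)
  qed
  have "map_poly complex_of_real (char_poly A) = (\<Prod>a\<leftarrow>as. [:- a, 1:])"
    using of_real_hom.char_poly_hom[OF A, where 'a = complex] as by simp
  also have "\<dots> = map_poly complex_of_real (\<Prod>e\<leftarrow>map Re as. [:- e, 1:])"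
    using real
  proof (induction as)
    case (Cons a as)
    interpret map_poly_comm_ring_hom "of_real :: real \<Rightarrow> complex" ..
    show ?case using Cons by (simp add: hom_mult del: mult_pCons_left)
  qed simp
  finally have "char_poly A = (\<Prod>e\<leftarrow>map Re as. [:- e, 1:])"
    by (auto simp: poly_eq_iff coeff_map_poly)
  then show ?thesis using as(2) by (metis length_map)
qed

lemma proots_linear_factors:
  fixes es :: "'a :: idom list"
  shows "proots (\<Prod>e\<leftarrow>es. [:- e, 1:]) = mset es"
proof (induction es)
  case (Cons e es)
  have "(\<Prod>e\<leftarrow>es. [:- e, 1:]) \<noteq> 0" by (auto simp: prod_list_zero_iff)
  then have "proots ([:- e, 1:] * (\<Prod>e\<leftarrow>es. [:- e, 1:])) = proots [:- e, 1:] + proots (\<Prod>e\<leftarrow>es. [:- e, 1:])"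
    by (intro proots_mult) simp
  then show ?case using Cons by (simp del: mult_pCons_left)
qed simp

text \<open>Some nonzero combination of \<open>u\<close> and \<open>w\<close> has sum \<open>0\<close>, and \<open>a\<close> maps the span of \<open>u\<close> and \<open>w\<close>
  to itself with eigenvalues \<open>l0\<close> and \<open>l1\<close>.\<close>

lemma second_eigenvalue_le:
  fixes a :: "nat \<Rightarrow> nat \<Rightarrow> real"
  assumes sym: "\<And>i j. i < n \<Longrightarrow> j < n \<Longrightarrow> a i j = a j i"
    and u: "\<And>i. i < n \<Longrightarrow> (\<Sum>j<n. a i j * u j) = l0 * u i"
    and w: "\<And>i. i < n \<Longrightarrow> (\<Sum>j<n. a i j * w j) = b * u i + l1 * w i"
    and indep: "\<And>s t. (\<And>i. i < n \<Longrightarrow> s * u i + t * w i = 0) \<Longrightarrow> s = 0 \<and> t = 0"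
    and le: "l1 \<le> l0"
    and form: "\<And>h. (\<Sum>i<n. h i) = 0 \<Longrightarrow> (\<Sum>i<n. \<Sum>j<n. h i * a i j * h j) \<le> c * (\<Sum>i<n. (h i)\<^sup>2)"
  shows "l1 \<le> c"
proof -
  define uu where "uu = (\<Sum>i<n. (u i)\<^sup>2)"
  define uw where "uw = (\<Sum>i<n. u i * w i)"
  have pos: "(\<Sum>i<n. (s * u i + t * w i)\<^sup>2) > 0" if st: "s \<noteq> 0 \<or> t \<noteq> 0" for s t
  proof -
    from indep st obtain k where "k < n" "s * u k + t * w k \<noteq> 0" by blast
    then show ?thesis by (intro sum_pos2[where i = k]) auto
  qed
  have uu: "uu > 0" using pos[of 1 0] by (simp add: uu_def)
  \<comment> \<open>The inner product of \<open>u\<close> with the image of \<open>w\<close>,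
    computed in two ways by symmetry, determines \<open>b\<close>.\<close>
  have "(\<Sum>i<n. \<Sum>j<n. u i * (a i j * w j)) = (\<Sum>j<n. \<Sum>i<n. u i * (a i j * w j))"
    by (rule sum.swap)
  also have "\<dots> = (\<Sum>j<n. w j * (\<Sum>i<n. a j i * u i))"
    using sym by (simp add: sum_distrib_left mult_ac)
  also have "\<dots> = (\<Sum>j<n. w j * (l0 * u j))"
    by (simp add: u)
  also have "\<dots> = l0 * uw"
    by (simp add: uw_def sum_distrib_left mult_ac)
  also have "(\<Sum>i<n. \<Sum>j<n. u i * (a i j * w j)) = b * uu + l1 * uw"
    by (simp add: sum_distrib_left[symmetric] w uu_def uw_def)
      (simp add: algebra_simps sum.distrib sum_distrib_left power2_eq_square)
  finally have b: "b * uu = (l0 - l1) * uw" by (simp add: algebra_simps)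
  define su where "su = (\<Sum>i<n. u i)"
  define sw where "sw = (\<Sum>i<n. w i)"
  obtain s t where st: "s \<noteq> 0 \<or> t \<noteq> 0" "s * su + t * sw = 0"
    by (cases "su = 0 \<and> sw = 0") (auto intro: that[of 1 0] that[of sw "- su"])
  define h where "h i = s * u i + t * w i" for i
  define hh where "hh = (\<Sum>i<n. (h i)\<^sup>2)"
  have hh: "hh > 0" unfolding hh_def h_def by (rule pos[OF st(1)])
  have h0: "(\<Sum>i<n. h i) = 0"
    using st(2) by (simp add: h_def sum.distrib sum_distrib_left[symmetric] su_def sw_def)
  have hu: "(\<Sum>i<n. h i * u i) = s * uu + t * uw"
    by (simp add: h_def uu_def uw_def algebra_simps sum.distrib sum_distrib_left power2_eq_square)
  have row: "(\<Sum>j<n. a i j * h j) = l1 * h i + (s * (l0 - l1) + t * b) * u i" if "i < n" for i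
  proof -
    have "(\<Sum>j<n. a i j * h j) = s * (\<Sum>j<n. a i j * u j) + t * (\<Sum>j<n. a i j * w j)"
      by (simp add: h_def algebra_simps sum.distrib sum_distrib_left)
    then show ?thesis using that by (simp add: u w) (simp add: h_def algebra_simps)
  qed
  have "(\<Sum>i<n. \<Sum>j<n. h i * a i j * h j) = (\<Sum>i<n. h i * (l1 * h i + (s * (l0 - l1) + t * b) * u i))"
    by (simp add: mult.assoc sum_distrib_left[symmetric] row)
  also have "\<dots> = l1 * hh + (s * (l0 - l1) + t * b) * (\<Sum>i<n. h i * u i)"
    by (simp add: hh_def algebra_simps sum.distrib sum_subtractf sum_distrib_left power2_eq_square)
  also have "\<dots> = l1 * hh + (s * (l0 - l1) + t * b) * (s * uu + t * uw)"
    by (simp add: hu)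
  finally have "l1 * hh + (s * (l0 - l1) + t * b) * (s * uu + t * uw) \<le> c * hh"
    using form[OF h0] by (simp add: hh_def)
  \<comment> \<open>Multiplied by \<open>uu\<close>, the product becomes \<open>l0 - l1\<close>
    times the square of the inner product of \<open>h\<close> and \<open>u\<close>. Hence the
    Rayleigh quotient of \<open>h\<close> is at least \<open>l1\<close>.\<close>
  moreover have "0 \<le> (s * (l0 - l1) + t * b) * (s * uu + t * uw)"
  proof -
    have "(s * (l0 - l1) + t * b) * uu = s * (l0 - l1) * uu + t * (b * uu)"
      by (simp add: algebra_simps)
    also have "\<dots> = (l0 - l1) * (s * uu + t * uw)"
      unfolding b by (simp add: algebra_simps)
    finally have "(s * (l0 - l1) + t * b) * (s * uu + t * uw) * uu = (l0 - l1) * (s * uu + t * uw)\<^sup>2"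
      by (simp add: power2_eq_square mult.commute mult.left_commute)
    then have "0 \<le> (s * (l0 - l1) + t * b) * (s * uu + t * uw) * uu" using le by simp
    then show ?thesis using uu by (simp add: zero_le_mult_iff)
  qed
  ultimately have "l1 * hh \<le> c * hh" by linarith
  then show ?thesis using hh by simp
qed

text \<open>By \<open>psd\<close> the spectrum is nonnegative, so the last eigenvalue is dominated
  by the second. The second is bounded by a min-max argument on an invariant plane, which contains a
  nonzero function of sum 0.\<close>

lemma lambda_star_le:
  fixes P :: "'s \<Rightarrow> 's \<Rightarrow> real"
  assumes card: "2 \<le> card S" and sym: "\<And>s t. s \<in> S \<Longrightarrow> t \<in> S \<Longrightarrow> P s t = P t s"
    and psd: "\<And>h. 0 \<le> (\<Sum>s\<in>S. \<Sum>t\<in>S. h s * P s t * h t)"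
    and gap: "\<And>h. (\<Sum>s\<in>S. h s) = 0 \<Longrightarrow> (\<Sum>s\<in>S. \<Sum>t\<in>S. h s * P s t * h t) \<le> c * (\<Sum>s\<in>S. (h s)\<^sup>2)"
  shows "lambda_star S P \<le> c"
proof -
  define n where "n = card S"
  have fin: "finite S" using card card.infinite by fastforce
  define \<iota> where "\<iota> = from_nat_into S"
  have bij: "bij_betw \<iota> {..<n} S" unfolding \<iota>_def n_def using fin by (rule bij_betw_from_nat_into_finite)
  define a where "a i j = P (\<iota> i) (\<iota> j)" for i j
  define A where "A = transition_matrix S P"
  have A: "A \<in> carrier_mat n n" unfolding A_def transition_matrix_def n_def by simp
  have Aij: "A $$ (i, j) = a i j" if "i < n" "j < n" for i j
    using that by (simp add: A_def transition_matrix_def n_def a_def \<iota>_def)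
  have \<iota>: "\<iota> i \<in> S" if "i < n" for i using bij that by (auto simp: bij_betw_def)
  have a_sym: "a i j = a j i" if "i < n" "j < n" for i j
    unfolding a_def using \<iota> that by (intro sym)
  have reindex: "(\<Sum>s\<in>S. F s) = (\<Sum>i<n. F (\<iota> i))" for F :: "'s \<Rightarrow> real"
    using sum.reindex_bij_betw[OF bij, of F] by simp
  have lift: "\<exists>g. \<forall>i<n. g (\<iota> i) = h i" for h :: "nat \<Rightarrow> real"
    using bij by (intro exI[of _ "\<lambda>s. h (the_inv_into {..<n} \<iota> s)"])
      (auto simp: bij_betw_def the_inv_into_f_f)
  have psd': "0 \<le> (\<Sum>i<n. \<Sum>j<n. h i * a i j * h j)" for h
  proof -
    obtain g where g: "\<forall>i<n. g (\<iota> i) = h i" using lift by blast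
    show ?thesis using psd[of g] g by (simp add: reindex a_def)
  qed
  have gap': "(\<Sum>i<n. \<Sum>j<n. h i * a i j * h j) \<le> c * (\<Sum>i<n. (h i)\<^sup>2)" if "(\<Sum>i<n. h i) = 0" for h
  proof -
    obtain g where g: "\<forall>i<n. g (\<iota> i) = h i" using lift by blast
    show ?thesis using gap[of g] g that by (simp add: reindex a_def)
  qed
  define es where "es = chain_eigenvalues S P"
  obtain es' where es': "char_poly A = (\<Prod>e\<leftarrow>es'. [:- e, 1:])" "length es' = n"
    using symmetric_char_poly_splits[OF A] a_sym by (auto simp: Aij)
  have "mset es = mset es'"
    unfolding es_def chain_eigenvalues_def A_def[symmetric] es'(1) proots_linear_factors by simp
  then have len: "length es = n" and cp: "char_poly A = (\<Prod>e\<leftarrow>es. [:- e, 1:])"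
    using es' by (metis mset_eq_length, metis mset_map prod_mset_prod_list)
  have "sorted (rev es)" unfolding es_def chain_eigenvalues_def by simp
  then have desc: "es ! j \<le> es ! i" if "i \<le> j" "j < n" for i j
    using that len by (simp add: sorted_rev_nth_mono)
  have n2: "2 \<le> n" using card by (simp add: n_def)
  have es1: "es ! 1 \<le> c"
  proof -
    \<comment> \<open>In the Schur form with descending diagonal, the first two columns of
      \<open>X\<close> span an invariant plane with eigenvalues \<open>es ! 0\<close> and
      \<open>es ! 1\<close>.\<close>
    obtain B X Y where dec: "schur_decomposition A es = (B, X, Y)" by (metis prod_cases3)
    have sim: "similar_mat_wit A B X Y" and ut: "upper_triangular B" and diag: "diag_mat B = es"
      using schur_decomposition[OF A cp dec] by auto
    have X: "X \<in> carrier_mat n n" and Y: "Y \<in> carrier_mat n n" and B: "B \<in> carrier_mat n n"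
      and YX: "Y * X = 1\<^sub>m n" and AB: "A = X * B * Y"
      using sim A unfolding similar_mat_wit_def by (auto simp: Let_def)
    have AX: "A * X = X * B"
      using X Y B by (simp add: AB YX assoc_mult_mat[of _ n n _ n _ n])
    have AXij: "(\<Sum>j<n. a i j * X $$ (j, k)) = (\<Sum>j<n. X $$ (i, j) * B $$ (j, k))" if "i < n" "k < n" for i k
    proof -
      have "(A * X) $$ (i, k) = (X * B) $$ (i, k)" by (simp add: AX)
      then show ?thesis
        using that A X B by (simp add: scalar_prod_def atLeast0LessThan Aij)
    qed
    have Bjk: "B $$ (j, k) = 0" if "k < j" "j < n" for j k
      using ut B that by (auto dest: upper_triangularD)
    have Bd: "B $$ (j, j) = es ! j" if "j < n" for j
      using diag B that by (auto simp: diag_mat_def)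
    have YXij: "(\<Sum>j<n. Y $$ (i, j) * X $$ (j, k)) = (if i = k then 1 else 0)" if "i < n" "k < n" for i k
    proof -
      have "(Y * X) $$ (i, k) = (1\<^sub>m n :: real mat) $$ (i, k)" by (simp add: YX)
      then show ?thesis using that X Y by (simp add: scalar_prod_def atLeast0LessThan)
    qed
    show ?thesis
    proof (rule second_eigenvalue_le[where n = n and a = a and u = "\<lambda>i. X $$ (i, 0)"
          and w = "\<lambda>i. X $$ (i, 1)" and ?l0.0 = "es ! 0" and b = "B $$ (0, 1)"])
      fix i assume i: "i < n"
      have "(\<Sum>j<n. X $$ (i, j) * B $$ (j, 0)) = (\<Sum>j\<in>{0}. X $$ (i, j) * B $$ (j, 0))"
        using n2 Bjk[of 0] by (intro sum.mono_neutral_right) auto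
      then show "(\<Sum>j<n. a i j * X $$ (j, 0)) = es ! 0 * X $$ (i, 0)"
        using AXij[OF i, of 0] Bd[of 0] n2 by (simp add: mult.commute)
      have "(\<Sum>j<n. X $$ (i, j) * B $$ (j, 1)) = (\<Sum>j\<in>{0, 1}. X $$ (i, j) * B $$ (j, 1))"
      proof (intro sum.mono_neutral_right ballI)
        fix j assume "j \<in> {..<n} - {0, 1}"
        then show "X $$ (i, j) * B $$ (j, 1) = 0" using Bjk[of 1 j] by force
      qed (use n2 in auto)
      then show "(\<Sum>j<n. a i j * X $$ (j, 1)) = B $$ (0, 1) * X $$ (i, 0) + es ! 1 * X $$ (i, 1)"
        using AXij[OF i, of 1] Bd[of 1] n2 by (simp add: mult.commute)
    next
      fix s t assume st: "\<And>i. i < n \<Longrightarrow> s * X $$ (i, 0) + t * X $$ (i, 1) = 0"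
      have "s * (\<Sum>j<n. Y $$ (k, j) * X $$ (j, 0)) + t * (\<Sum>j<n. Y $$ (k, j) * X $$ (j, 1))
          = (\<Sum>j<n. Y $$ (k, j) * (s * X $$ (j, 0) + t * X $$ (j, 1)))" for k
        by (simp add: algebra_simps sum.distrib sum_distrib_left)
      also have "\<dots> k = 0" for k by (intro sum.neutral ballI) (use st in auto)
      finally have eq: "s * (\<Sum>j<n. Y $$ (k, j) * X $$ (j, 0)) + t * (\<Sum>j<n. Y $$ (k, j) * X $$ (j, 1)) = 0" for k .
      show "s = 0 \<and> t = 0"
        using eq[of 0] eq[of 1] YXij[of 0 0] YXij[of 0 1] YXij[of 1 0] YXij[of 1 1] n2 by simp
    next
      show "es ! 1 \<le> es ! 0" using n2 by (intro desc) auto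
    qed (use a_sym gap' in auto)
  qed
  have "0 \<le> e" if e: "e \<in> set es" for e
  proof -
    have "poly (char_poly A) e = 0"
      unfolding cp poly_prod_list using e by (auto simp: prod_list_zero_iff image_iff intro!: bexI[of _ e])
    then obtain v where v: "v \<in> carrier_vec n" "v \<noteq> 0\<^sub>v n" "A *\<^sub>v v = e \<cdot>\<^sub>v v"
      using eigenvalue_root_char_poly[OF A] A unfolding eigenvalue_def eigenvector_def by auto
    have row: "(\<Sum>j<n. a i j * v $ j) = e * v $ i" if "i < n" for i
    proof -
      have "(A *\<^sub>v v) $ i = (e \<cdot>\<^sub>v v) $ i" using v by simp
      then show ?thesis using that A v(1) by (simp add: scalar_prod_def atLeast0LessThan Aij)
    qed
    obtain k where k: "k < n" "v $ k \<noteq> 0" using v by (metis carrier_vecD eq_vecI index_zero_vec)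
    have "0 \<le> (\<Sum>i<n. \<Sum>j<n. v $ i * a i j * v $ j)" by (rule psd')
    also have "\<dots> = e * (\<Sum>i<n. (v $ i)\<^sup>2)"
      by (simp add: mult.assoc sum_distrib_left[symmetric] row)
        (simp add: sum_distrib_left power2_eq_square mult_ac)
    finally have "0 \<le> e * (\<Sum>i<n. (v $ i)\<^sup>2)" .
    moreover have "(\<Sum>i<n. (v $ i)\<^sup>2) > 0" using k by (intro sum_pos2[where i = k]) auto
    ultimately show ?thesis by (simp add: zero_le_mult_iff)
  qed
  moreover have ne: "es \<noteq> []" using len n2 by auto
  ultimately have "0 \<le> last es" by simp
  moreover have "last es \<le> es ! 1"
    using n2 len ne by (simp add: last_conv_nth desc)
  ultimately show ?thesis
    using es1 n2 unfolding lambda_star_def es_def[symmetric] n_def by simp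
qed

section \<open>The Glauber dynamics\<close>

lemma glauber_update_available:
  assumes "c \<in> {1..q}"
  shows "glauber_update E \<sigma> e c = (if c \<in> available E q \<sigma> e then \<sigma>(e := c) else \<sigma>)"
  using assms unfolding glauber_update_def available_def by auto

lemma glauber_update_edge_colorings:
  assumes "\<sigma> \<in> edge_colorings E q" "e \<in> E" "c \<in> {1..q}"
  shows "glauber_update E \<sigma> e c \<in> edge_colorings E q"
  using assms by (simp add: glauber_update_available[where q = q] fun_upd_edge_colorings)

text \<open>A move that changes the coloring is undone by choosing the same edge and its old color,
  which injects the moves from \<sigma> to \<tau> into those from \<tau> to \<sigma>.\<close>

lemma glauber_prob_sym:
  assumes "finite E" "\<sigma> \<in> edge_colorings E q" "\<tau> \<in> edge_colorings E q"
  shows "glauber_prob E q \<sigma> \<tau> = glauber_prob E q \<tau> \<sigma>"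
proof (cases "\<sigma> = \<tau>")
  case False
  define M where "M \<sigma> \<tau> = {(e, c) \<in> E \<times> {1..q}. glauber_update E \<sigma> e c = \<tau>}" for \<sigma> \<tau>
  have fM: "finite (M \<sigma> \<tau>)" for \<sigma> \<tau>
    by (rule finite_subset[of _ "E \<times> {1..q}"]) (use assms(1) in \<open>auto simp: M_def\<close>)
  have "card (M \<sigma> \<tau>) \<le> card (M \<tau> \<sigma>)"
    if st: "\<sigma> \<in> edge_colorings E q" "\<tau> \<in> edge_colorings E q" "\<sigma> \<noteq> \<tau>" for \<sigma> \<tau>
  proof (rule card_inj_on_le[of "\<lambda>(e, c). (e, \<sigma> e)"])
    have move: "c \<in> available E q \<sigma> e \<and> \<tau> = \<sigma>(e := c)" if "(e, c) \<in> M \<sigma> \<tau>" for e c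
      using that st(3) by (auto simp: M_def glauber_update_available[where q = q] split: if_splits)
    show "inj_on (\<lambda>(e, c). (e, \<sigma> e)) (M \<sigma> \<tau>)"
      using move by (auto simp: inj_on_def) (metis fun_upd_same)
    show "(\<lambda>(e, c). (e, \<sigma> e)) ` M \<sigma> \<tau> \<subseteq> M \<tau> \<sigma>"
    proof (clarsimp)
      fix e c assume ec: "(e, c) \<in> M \<sigma> \<tau>"
      then have e: "e \<in> E" by (simp add: M_def)
      have \<tau>: "\<tau> = \<sigma>(e := c)" using move[OF ec] by simp
      have "\<sigma> e \<in> available E q \<tau> e"
        using available_self[OF st(1) e] by (simp add: \<tau> available_fun_upd)
      moreover from this have "\<sigma> e \<in> {1..q}" by (simp add: available_def)
      ultimately have "glauber_update E \<tau> e (\<sigma> e) = \<sigma>"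
        by (simp add: glauber_update_available[where q = q]) (simp add: \<tau>)
      then show "(e, \<sigma> e) \<in> M \<tau> \<sigma>"
        using e \<open>\<sigma> e \<in> {1..q}\<close> by (simp add: M_def)
    qed
  qed (rule fM)
  from this[of \<sigma> \<tau>] this[of \<tau> \<sigma>] assms False have "card (M \<sigma> \<tau>) = card (M \<tau> \<sigma>)" by auto
  then show ?thesis unfolding glauber_prob_def M_def by simp
qed simp

lemma sum_glauber_prob:
  fixes h :: "('v set \<Rightarrow> nat) \<Rightarrow> real"
  assumes fin: "finite E" and \<sigma>: "\<sigma> \<in> edge_colorings E q"
  shows "(\<Sum>\<tau>\<in>edge_colorings E q. glauber_prob E q \<sigma> \<tau> * h \<tau>)
    = (\<Sum>e\<in>E. \<Sum>c\<in>{1..q}. h (glauber_update E \<sigma> e c)) / real (card E * q)"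
proof -
  let ?X = "E \<times> {1..q}" and ?g = "\<lambda>(e, c). glauber_update E \<sigma> e c"
  have "real (card {(e, c) \<in> E \<times> {1..q}. glauber_update E \<sigma> e c = \<tau>}) * h \<tau>
      = (\<Sum>p\<in>{p \<in> ?X. ?g p = \<tau>}. h (?g p))" for \<tau>
  proof -
    have "{(e, c) \<in> E \<times> {1..q}. glauber_update E \<sigma> e c = \<tau>} = {p \<in> ?X. ?g p = \<tau>}" by auto
    moreover have "(\<Sum>p\<in>{p \<in> ?X. ?g p = \<tau>}. h (?g p)) = (\<Sum>p\<in>{p \<in> ?X. ?g p = \<tau>}. h \<tau>)"
      by (intro sum.cong refl) auto
    ultimately show ?thesis by simp
  qed
  then have "(\<Sum>\<tau>\<in>edge_colorings E q. glauber_prob E q \<sigma> \<tau> * h \<tau>)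
      = (\<Sum>\<tau>\<in>edge_colorings E q. \<Sum>p\<in>{p \<in> ?X. ?g p = \<tau>}. h (?g p)) / real (card E * q)"
    unfolding glauber_prob_def by (simp only: times_divide_eq_left sum_divide_distrib)
  also have "(\<Sum>\<tau>\<in>edge_colorings E q. \<Sum>p\<in>{p \<in> ?X. ?g p = \<tau>}. h (?g p)) = (\<Sum>p\<in>?X. h (?g p))"
    using fin finite_edge_colorings[OF fin] glauber_update_edge_colorings[OF \<sigma>]
    by (intro sum.group) auto
  also have "\<dots> = (\<Sum>e\<in>E. \<Sum>c\<in>{1..q}. h (glauber_update E \<sigma> e c))"
    by (simp add: sum.cartesian_product case_prod_unfold)
  finally show ?thesis .
qed

text \<open>A color is drawn from all \<open>q\<close> colors, so the update at an edge with \<open>k\<close> available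
  colors is a lazy version of resampling the color, with weight \<open>k / q\<close>. Resampling is an
  orthogonal projection, hence the chain is positive semidefinite.\<close>

lemma glauber_quadratic_form:
  fixes h :: "('v set \<Rightarrow> nat) \<Rightarrow> real"
  assumes fin: "finite E"
  shows "(\<Sum>\<sigma>\<in>edge_colorings E q. \<Sum>\<tau>\<in>edge_colorings E q. h \<sigma> * glauber_prob E q \<sigma> \<tau> * h \<tau>)
    = (\<Sum>e\<in>E. \<Sum>\<sigma>\<in>edge_colorings E q.
        real (card (available E q \<sigma> e)) * (mean (available E q \<sigma> e) (\<lambda>c. h (\<sigma>(e := c))))\<^sup>2
        + (real q - real (card (available E q \<sigma> e))) * (h \<sigma>)\<^sup>2) / real (card E * q)"
proof -
  let ?O = "edge_colorings E q"
  define k where "k e \<sigma> = real (card (available E q \<sigma> e))" for e \<sigma>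
  define m where "m e \<sigma> = mean (available E q \<sigma> e) (\<lambda>c. h (\<sigma>(e := c)))" for e \<sigma>
  have upd: "(\<Sum>c\<in>{1..q}. h (glauber_update E \<sigma> e c)) = k e \<sigma> * m e \<sigma> + (real q - k e \<sigma>) * h \<sigma>"
    if "e \<in> E" for \<sigma> e
  proof -
    let ?A = "available E q \<sigma> e"
    have sub: "?A \<subseteq> {1..q}" by (auto simp: available_def)
    have "(\<Sum>c\<in>{1..q}. h (glauber_update E \<sigma> e c))
        = (\<Sum>c\<in>{1..q} - ?A. h (glauber_update E \<sigma> e c)) + (\<Sum>c\<in>?A. h (glauber_update E \<sigma> e c))"
      using sub by (intro sum.subset_diff) auto
    also have "(\<Sum>c\<in>{1..q} - ?A. h (glauber_update E \<sigma> e c)) = (\<Sum>c\<in>{1..q} - ?A. h \<sigma>)"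
      by (intro sum.cong refl) (simp add: glauber_update_available[where q = q])
    also have "\<dots> = (real q - k e \<sigma>) * h \<sigma>"
      using sub card_mono[OF _ sub]
      by (simp add: card_Diff_subset finite_available k_def of_nat_diff)
    also have "(\<Sum>c\<in>?A. h (glauber_update E \<sigma> e c)) = (\<Sum>c\<in>?A. h (\<sigma>(e := c)))"
      using sub by (intro sum.cong refl) (auto simp: glauber_update_available[where q = q])
    also have "\<dots> = k e \<sigma> * m e \<sigma>"
      by (cases "?A = {}") (simp_all add: k_def m_def mean_def finite_available)
    finally show ?thesis by simp
  qed
  \<comment> \<open>\<open>k e\<close> and \<open>m e\<close> do not see the color of
    \<open>e\<close>, so averaging over that color replaces \<open>h\<close> by
    \<open>m e\<close>.\<close>
  have proj: "(\<Sum>\<sigma>\<in>?O. h \<sigma> * (k e \<sigma> * m e \<sigma>)) = (\<Sum>\<sigma>\<in>?O. k e \<sigma> * (m e \<sigma>)\<^sup>2)" if e: "e \<in> E" for e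
  proof -
    have "(\<Sum>\<sigma>\<in>?O. h \<sigma> * (k e \<sigma> * m e \<sigma>))
        = (\<Sum>\<sigma>\<in>?O. mean (available E q \<sigma> e) (\<lambda>c. k e \<sigma> * m e \<sigma> * h (\<sigma>(e := c))))"
      using sum_resample[OF fin e, where G = "\<lambda>\<sigma>. k e \<sigma> * m e \<sigma> * h \<sigma>"]
      by (simp add: k_def m_def available_fun_upd mult.commute)
    also have "\<dots> = (\<Sum>\<sigma>\<in>?O. k e \<sigma> * (m e \<sigma>)\<^sup>2)"
      by (simp add: mean_cmult m_def[symmetric] power2_eq_square mult.assoc)
    finally show ?thesis .
  qed
  have "(\<Sum>\<sigma>\<in>?O. \<Sum>\<tau>\<in>?O. h \<sigma> * glauber_prob E q \<sigma> \<tau> * h \<tau>)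
      = (\<Sum>\<sigma>\<in>?O. h \<sigma> * ((\<Sum>e\<in>E. k e \<sigma> * m e \<sigma> + (real q - k e \<sigma>) * h \<sigma>) / real (card E * q)))"
    by (intro sum.cong refl)
      (simp only: mult.assoc sum_distrib_left[symmetric] sum_glauber_prob[OF fin] upd cong: sum.cong)
  also have "\<dots> = (\<Sum>e\<in>E. \<Sum>\<sigma>\<in>?O. h \<sigma> * (k e \<sigma> * m e \<sigma>) + (real q - k e \<sigma>) * (h \<sigma>)\<^sup>2) / real (card E * q)"
    by (subst sum.swap) (simp add: sum_distrib_left sum_divide_distrib power2_eq_square algebra_simps)
  also have "(\<Sum>e\<in>E. \<Sum>\<sigma>\<in>?O. h \<sigma> * (k e \<sigma> * m e \<sigma>) + (real q - k e \<sigma>) * (h \<sigma>)\<^sup>2)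
      = (\<Sum>e\<in>E. \<Sum>\<sigma>\<in>?O. k e \<sigma> * (m e \<sigma>)\<^sup>2 + (real q - k e \<sigma>) * (h \<sigma>)\<^sup>2)"
    by (rule sum.cong[OF refl]) (simp add: sum.distrib proj)
  finally show ?thesis unfolding k_def m_def .
qed

lemma card_available_le: "card (available E q \<sigma> e) \<le> q"
  using card_mono[of "{1..q}" "available E q \<sigma> e"] by (auto simp: available_def)

text \<open>The current color is always available, so \<open>k \<ge> 1\<close> and an update of
  \<open>e\<close> resamples with weight at least \<open>1 / q\<close>. This compares the Dirichlet
  form of the chain with the local variances.\<close>

lemma glauber_gap:
  fixes h :: "('v set \<Rightarrow> nat) \<Rightarrow> real"
  assumes fin: "finite E" and ne: "E \<noteq> {}" and q: "0 < q" and C: "0 < C"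
    and tensor: "vari (edge_colorings E q) h \<le> C * (\<Sum>e\<in>E. local_vari E q e h)"
    and sum0: "(\<Sum>\<sigma>\<in>edge_colorings E q. h \<sigma>) = 0"
  shows "(\<Sum>\<sigma>\<in>edge_colorings E q. \<Sum>\<tau>\<in>edge_colorings E q. h \<sigma> * glauber_prob E q \<sigma> \<tau> * h \<tau>)
    \<le> (1 - 1 / (C * real (card E * q))) * (\<Sum>\<sigma>\<in>edge_colorings E q. (h \<sigma>)\<^sup>2)"
proof -
  let ?O = "edge_colorings E q"
  define k where "k e \<sigma> = real (card (available E q \<sigma> e))" for e \<sigma>
  define m where "m e \<sigma> = mean (available E q \<sigma> e) (\<lambda>c. h (\<sigma>(e := c)))" for e \<sigma>
  define v where "v e \<sigma> = vari (available E q \<sigma> e) (\<lambda>c. h (\<sigma>(e := c)))" for e \<sigma>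
  define M where "M = real (card E * q)"
  define H where "H = (\<Sum>\<sigma>\<in>?O. (h \<sigma>)\<^sup>2)"
  have M: "M > 0" using fin ne q by (simp add: M_def card_gt_0_iff)
  have edge: "(\<Sum>\<sigma>\<in>?O. k e \<sigma> * (m e \<sigma>)\<^sup>2 + (real q - k e \<sigma>) * (h \<sigma>)\<^sup>2) \<le> real q * H - (\<Sum>\<sigma>\<in>?O. v e \<sigma>)"
    if e: "e \<in> E" for e
  proof -
    have "(\<Sum>\<sigma>\<in>?O. k e \<sigma> * (h \<sigma>)\<^sup>2)
        = (\<Sum>\<sigma>\<in>?O. mean (available E q \<sigma> e) (\<lambda>c. k e \<sigma> * (h (\<sigma>(e := c)))\<^sup>2))"
      using sum_resample[OF fin e, where G = "\<lambda>\<sigma>. k e \<sigma> * (h \<sigma>)\<^sup>2"] by (simp add: k_def available_fun_upd)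
    also have "\<dots> = (\<Sum>\<sigma>\<in>?O. k e \<sigma> * (v e \<sigma> + (m e \<sigma>)\<^sup>2))"
      by (simp add: mean_cmult v_def m_def vari_eq)
    also have "\<dots> \<ge> (\<Sum>\<sigma>\<in>?O. v e \<sigma> + k e \<sigma> * (m e \<sigma>)\<^sup>2)"
    proof (rule sum_mono)
      fix \<sigma> assume "\<sigma> \<in> ?O"
      then have "available E q \<sigma> e \<noteq> {}" using available_self e by blast
      then have "0 < card (available E q \<sigma> e)" by (simp add: card_gt_0_iff finite_available)
      then have "1 \<le> k e \<sigma>" unfolding k_def by linarith
      then have "1 * v e \<sigma> \<le> k e \<sigma> * v e \<sigma>" by (intro mult_right_mono) (simp_all add: v_def vari_nonneg)
      then show "v e \<sigma> + k e \<sigma> * (m e \<sigma>)\<^sup>2 \<le> k e \<sigma> * (v e \<sigma> + (m e \<sigma>)\<^sup>2)" by (simp add: distrib_left)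
    qed
    finally show ?thesis
      by (simp add: sum.distrib sum_subtractf left_diff_distrib sum_distrib_left[symmetric] H_def)
  qed
  have "(\<Sum>\<sigma>\<in>?O. \<Sum>\<tau>\<in>?O. h \<sigma> * glauber_prob E q \<sigma> \<tau> * h \<tau>)
    = (\<Sum>e\<in>E. \<Sum>\<sigma>\<in>?O. k e \<sigma> * (m e \<sigma>)\<^sup>2 + (real q - k e \<sigma>) * (h \<sigma>)\<^sup>2) / M"
    unfolding glauber_quadratic_form[OF fin] k_def m_def M_def ..
  also have "\<dots> \<le> (\<Sum>e\<in>E. real q * H - (\<Sum>\<sigma>\<in>?O. v e \<sigma>)) / M"
    using M by (intro divide_right_mono sum_mono edge) auto
  also have "\<dots> = H - (\<Sum>e\<in>E. \<Sum>\<sigma>\<in>?O. v e \<sigma>) / M"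
    using fin ne q by (simp add: sum_subtractf diff_divide_distrib M_def)
  also have "\<dots> \<le> H - H / C / M"
  proof -
    \<comment> \<open>By \<open>sum0\<close> the mean of \<open>h\<close> is 0, so its second moment
      is its variance.\<close>
    have "H = real (card ?O) * vari ?O h"
      using sum0 fin finite_edge_colorings[OF fin]
      by (cases "?O = {}") (simp_all add: vari_def mean_def H_def)
    also have "\<dots> \<le> real (card ?O) * (C * (\<Sum>e\<in>E. local_vari E q e h))"
      by (intro mult_left_mono tensor) simp
    also have "\<dots> = C * (\<Sum>e\<in>E. real (card ?O) * local_vari E q e h)"
      by (simp add: sum_distrib_left mult_ac)
    also have "(\<Sum>e\<in>E. real (card ?O) * local_vari E q e h) = (\<Sum>e\<in>E. \<Sum>\<sigma>\<in>?O. v e \<sigma>)"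
      using finite_edge_colorings[OF fin]
      by (cases "?O = {}") (simp_all add: local_vari_def mean_def v_def)
    finally have "H / C \<le> (\<Sum>e\<in>E. \<Sum>\<sigma>\<in>?O. v e \<sigma>)" using C by (simp add: divide_le_eq mult.commute)
    then show ?thesis using M by (intro diff_left_mono divide_right_mono) auto
  qed
  also have "\<dots> = (1 - 1 / (C * M)) * H" by (simp add: left_diff_distrib)
  finally show ?thesis unfolding H_def M_def .
qed

lemma relaxation_time_glauber_le:
  assumes fin: "finite E" and ne: "E \<noteq> {}" and q: "0 < q" and C: "0 < C"
    and card: "2 \<le> card (edge_colorings E q)"
    and tensor: "\<And>h. vari (edge_colorings E q) h \<le> C * (\<Sum>e\<in>E. local_vari E q e h)"
  shows "relaxation_time (edge_colorings E q) (glauber_prob E q) \<le> ereal (C * real (card E * q))"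
proof -
  define M where "M = C * real (card E * q)"
  have M: "M > 0" using fin ne q C by (simp add: M_def card_gt_0_iff)
  have "lambda_star (edge_colorings E q) (glauber_prob E q) \<le> 1 - 1 / M"
  proof (rule lambda_star_le[OF card])
    show "glauber_prob E q s t = glauber_prob E q t s"
      if "s \<in> edge_colorings E q" "t \<in> edge_colorings E q" for s t
      using glauber_prob_sym[OF fin that] .
    show "0 \<le> (\<Sum>s\<in>edge_colorings E q. \<Sum>t\<in>edge_colorings E q. h s * glauber_prob E q s t * h t)" for h
      unfolding glauber_quadratic_form[OF fin]
      by (intro divide_nonneg_nonneg sum_nonneg add_nonneg_nonneg mult_nonneg_nonneg)
        (simp_all add: card_available_le)
    show "(\<Sum>s\<in>edge_colorings E q. \<Sum>t\<in>edge_colorings E q. h s * glauber_prob E q s t * h t)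
        \<le> (1 - 1 / M) * (\<Sum>s\<in>edge_colorings E q. (h s)\<^sup>2)"
      if "(\<Sum>s\<in>edge_colorings E q. h s) = 0" for h
      unfolding M_def using glauber_gap[OF fin ne q C tensor that] .
  qed
  then have *: "1 / M \<le> 1 - lambda_star (edge_colorings E q) (glauber_prob E q)" (is "_ \<le> ?g") by simp
  have "0 < 1 / M" using M by simp
  then have g: "0 < ?g" using * by linarith
  have "1 / ?g \<le> M" using * M g by (simp add: divide_simps mult.commute)
  then show ?thesis
    unfolding relaxation_time_def M_def[symmetric] using g by (simp add: one_ereal_def)
qed

section \<open>Choice of the constants and conclusion\<close>

lemma forest_tensorization:
  assumes q: "3 \<le> q"
  shows "\<exists>C > 0. \<forall>(E :: 'v set set) \<Delta> f. finite E \<longrightarrow> (\<forall>e\<in>E. card e = 2) \<longrightarrow> (\<nexists>xs. graph_cycle E xs) \<longrightarrow>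
    (\<forall>v. card {e \<in> E. v \<in> e} \<le> \<Delta>) \<longrightarrow> \<Delta> + 2 \<le> q \<longrightarrow>
    vari (edge_colorings E q) f \<le> C * (\<Sum>e\<in>E. local_vari E q e f)"
proof -
  define x where "x = 1 / real q"
  \<comment> \<open>The rate is at most \<open>1 - 2 * x\<close>; this \<epsilon> inflates it by
    about \<open>1 + x\<close>, so a gap of order \<open>x\<close> remains.\<close>
  define \<epsilon> where "\<epsilon> = x / 2"
  define \<delta> where "\<delta> = (1 + \<epsilon>)\<^sup>2 * (real (q - 3) / real (q - 1))"
  define K where "K = 4 * real q"
  define K' where "K' = (1 + \<epsilon>) * (1 + 1 / \<epsilon>) * real q + (1 + 1 / \<epsilon>)"
  define W where "W = K' * K / (1 - \<delta>)"
  have x: "0 < x" using q by (simp add: x_def)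
  then have eps: "0 < \<epsilon>" by (simp add: \<epsilon>_def)
  have "real (q - 3) / real (q - 1) \<le> 1 - 2 * x"
    using q by (simp add: x_def field_simps of_nat_diff)
  then have "\<delta> \<le> (1 + \<epsilon>)\<^sup>2 * (1 - 2 * x)"
    unfolding \<delta>_def by (intro mult_left_mono) auto
  also have "\<dots> = 1 - x - 7 / 4 * x\<^sup>2 - x ^ 3 / 2"
    by (simp add: \<epsilon>_def power2_eq_square power3_eq_cube field_simps)
  also have "\<dots> < 1"
    using x zero_less_power[OF x, of 3] zero_less_power[OF x, of 2] by linarith
  finally have \<delta>: "\<delta> < 1" .
  have K: "0 < K" using q by (simp add: K_def)
  have K': "1 \<le> K'" using eps by (simp add: K'_def add_increasing)
  have W: "0 < W" using K K' \<delta> by (simp add: W_def)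
  define C where "C = K + K' * W"
  have weight: "edge_weight K K' W n \<le> C" for n
  proof -
    have "W \<le> K' * W" "0 \<le> K' * W" using K' W by simp_all
    then show ?thesis using K by (simp add: edge_weight_def C_def)
  qed
  show ?thesis
  proof (intro exI[of _ C] conjI allI impI)
    show "0 < C" unfolding C_def using K K' W by (intro add_pos_pos mult_pos_pos) auto
    fix E :: "'v set set" and \<Delta> f
    assume E: "finite E" "\<forall>e\<in>E. card e = 2" "\<nexists>xs. graph_cycle E xs"
      "\<forall>v. card {e \<in> E. v \<in> e} \<le> \<Delta>" "\<Delta> + 2 \<le> q"
    have "vari (edge_colorings E q) f
        \<le> (\<Sum>e\<in>E. edge_weight K K' W (inner_ends E e) * local_vari E q e f)"
      using E by (intro forest_vari_le[OF _ _ _ _ _ eps K_def \<delta> _ K'_def W_def]) (auto simp: \<delta>_def)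
    also have "\<dots> \<le> (\<Sum>e\<in>E. C * local_vari E q e f)"
      by (intro sum_mono mult_right_mono weight local_vari_nonneg)
    finally show "vari (edge_colorings E q) f \<le> C * (\<Sum>e\<in>E. local_vari E q e f)"
      by (simp add: sum_distrib_left)
  qed
qed

theorem theorem1p1:
  shows "\<exists>C :: nat \<Rightarrow> nat \<Rightarrow> real.
    \<forall>(V :: 'v set) E \<Delta> q.
      is_tree V E \<and> max_degree V E = \<Delta> \<and> q \<ge> \<Delta> + 2 \<longrightarrow>
      relaxation_time (edge_colorings E q) (glauber_prob E q) \<le> ereal (C \<Delta> q * real (card V))"
proof -
  define tensor where "tensor q C \<longleftrightarrow> C > 0 \<and>
    (\<forall>(E :: 'v set set) \<Delta> f. finite E \<longrightarrow> (\<forall>e\<in>E. card e = 2) \<longrightarrow> (\<nexists>xs. graph_cycle E xs) \<longrightarrow>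
    (\<forall>v. card {e \<in> E. v \<in> e} \<le> \<Delta>) \<longrightarrow> \<Delta> + 2 \<le> q \<longrightarrow>
    vari (edge_colorings E q) f \<le> C * (\<Sum>e\<in>E. local_vari E q e f))" for q and C :: real
  have "\<exists>C. tensor q C" if "3 \<le> q" for q
    unfolding tensor_def using forest_tensorization[OF that, where 'v = 'v] by blast
  then obtain C0 where C0: "\<And>q. 3 \<le> q \<Longrightarrow> tensor q (C0 q)" by metis
  show ?thesis
  \<comment> \<open>The 1 covers a single coloring, where the relaxation time is 1 by convention;
    \<open>\<Delta>\<close> comes from \<open>card E \<le> card V * \<Delta>\<close>, and
    \<open>q\<close> from the laziness of the updates.\<close>
  proof (intro exI[of _ "\<lambda>\<Delta> q. max 1 (C0 q * real (\<Delta> * q))"] allI impI)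
    fix V :: "'v set" and E \<Delta> q
    assume asm: "is_tree V E \<and> max_degree V E = \<Delta> \<and> q \<ge> \<Delta> + 2"
    let ?O = "edge_colorings E q" and ?C = "max 1 (C0 q * real (\<Delta> * q))"
    have V: "finite V" "V \<noteq> {}" and E: "\<And>e. e \<in> E \<Longrightarrow> e \<subseteq> V" "\<And>e. e \<in> E \<Longrightarrow> card e = 2"
      and acyclic: "\<nexists>xs. graph_cycle E xs"
      using asm by (auto simp: is_tree_def simple_graph_def graph_connected_def)
    have finE: "finite E" using E(1) V(1) by (meson Pow_iff finite_Pow_iff finite_subset subsetI)
    have deg: "card {e \<in> E. v \<in> e} \<le> \<Delta>" for v
    proof (cases "v \<in> V")
      case True
      then have "graph_degree E v \<le> \<Delta>" using asm V by (auto simp: max_degree_def)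
      then show ?thesis by (simp add: graph_degree_def)
    next
      case False
      then have "{e \<in> E. v \<in> e} = {}" using E(1) by auto
      then show ?thesis by (metis card.empty le0)
    qed
    have "0 < card V" using V by (simp add: card_gt_0_iff)
    then have cV: "1 \<le> real (card V)" by linarith
    show "relaxation_time ?O (glauber_prob E q) \<le> ereal (?C * real (card V))"
    proof (cases "card ?O \<le> 1")
      case True
      have "1 * 1 \<le> ?C * real (card V)" using cV by (intro mult_mono) auto
      then show ?thesis using True by (simp add: relaxation_time_def lambda_star_def one_ereal_def)
    next
      case False
      have ne: "E \<noteq> {}"
      proof
        assume "E = {}"
        then have "?O = {\<lambda>_. undefined}" by (auto simp: edge_colorings_def)
        then show False using False by simp
      qed
      then obtain e v where "e \<in> E" "v \<in> e" using E(2) by (metis all_not_in_conv card.empty zero_neq_numeral)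
      then have "0 < card {e \<in> E. v \<in> e}" using finE by (auto simp: card_gt_0_iff)
      \<comment> \<open>An edge forces \<open>\<Delta> \<ge> 1\<close>, which brings
        \<open>q\<close> into the range where \<open>C0\<close> is specified.\<close>
      then have q3: "3 \<le> q" using deg[of v] asm by simp
      have C0q: "0 < C0 q" using C0[OF q3] by (simp add: tensor_def)
      have "vari ?O h \<le> C0 q * (\<Sum>e\<in>E. local_vari E q e h)" for h
        using C0[OF q3] finE E(2) acyclic deg asm unfolding tensor_def by blast
      then have "relaxation_time ?O (glauber_prob E q) \<le> ereal (C0 q * real (card E * q))"
        using False q3 by (intro relaxation_time_glauber_le finE ne C0q) auto
      also have "C0 q * real (card E * q) \<le> C0 q * real (\<Delta> * q) * real (card V)"
      proof -
        have "E \<subseteq> (\<Union>v\<in>V. {e \<in> E. v \<in> e})"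
        proof
          fix e assume e: "e \<in> E"
          then have "e \<noteq> {}" using E(2) by fastforce
          then show "e \<in> (\<Union>v\<in>V. {e \<in> E. v \<in> e})" using e E(1) by blast
        qed
        then have "card E \<le> card (\<Union>v\<in>V. {e \<in> E. v \<in> e})" using finE V by (intro card_mono) auto
        also have "\<dots> \<le> (\<Sum>v\<in>V. card {e \<in> E. v \<in> e})" using V by (intro card_UN_le) auto
        also have "\<dots> \<le> (\<Sum>v\<in>V. \<Delta>)" by (intro sum_mono deg)
        finally have "card E \<le> card V * \<Delta>" by simp
        then have "real (card E * q) \<le> real (card V * \<Delta> * q)" by (simp only: of_nat_le_iff mult_le_mono1)
        then have "C0 q * real (card E * q) \<le> C0 q * real (card V * \<Delta> * q)"
          using C0q by (intro mult_left_mono) auto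
        then show ?thesis by (simp add: mult_ac)
      qed
      also have "C0 q * real (\<Delta> * q) * real (card V) \<le> ?C * real (card V)"
        by (intro mult_right_mono) auto
      finally show ?thesis by simp
    qed
  qed
qed

end
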